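(* For every $q\ge 3$ and every constant $\delta$ there exists $\epsilon>0$ with the following property: for every constant $\sigma$, every instance $(G,L)$ of List Vertex Deletion to $q$-Coloring with $n$ vertices, given with a $(\sigma,\delta)$-hub of size $p$, can be solved in time $(q+1-\epsilon)^p\cdot n^{\mathcal{O}(1)}$.
   Context: For a graph $G$, a set $Q\subseteq V(G)$ is a $(\sigma,\delta)$-hub if every connected component of $G-Q$ has at most $\sigma$ vertices and is adjacent to at most $\delta$ vertices of $Q$. List Vertex Deletion to $q$-Coloring: given a graph $G$ and lists $L:V(G)\to 2^{\{1,\dots,q\}}$, find a minimum-size set $X\subseteq V(G)$ such that $G-X$ has a proper coloring $\phi$ with $\phi(v)\in L(v)$ for all $v\in V(G)\setminus X$. *)

theory Defs
  imports Complex_Main "Graph_Theory.Digraph_Component"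
begin

section \<open>Hubs and list vertex deletion to q-coloring\<close>

text \<open>
  A finite simple graph is a \<^term>\<open>pair_graph\<close>: a finite loop-free digraph whose arc relation
  is symmetric.  In such a graph strongly connected components are the connected components.
\<close>

definition del_verts :: "'a pair_pre_digraph \<Rightarrow> 'a set \<Rightarrow> ('a, 'a \<times> 'a) pre_digraph" where
  "del_verts G X = with_proj G \<restriction> (pverts G - X)"

definition is_hub :: "nat \<Rightarrow> nat \<Rightarrow> 'a pair_pre_digraph \<Rightarrow> 'a set \<Rightarrow> bool" where
  "is_hub \<sigma> \<delta> G Q \<longleftrightarrow> Q \<subseteq> pverts G \<and>
     (\<forall>C \<in> pre_digraph.sccs_verts (del_verts G Q).
        card C \<le> \<sigma> \<and> card {v \<in> Q. \<exists>u \<in> C. (u, v) \<in> parcs G} \<le> \<delta>)"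

definition proper_list_coloring ::
    "('a, 'b) pre_digraph \<Rightarrow> ('a \<Rightarrow> nat set) \<Rightarrow> ('a \<Rightarrow> nat) \<Rightarrow> bool" where
  "proper_list_coloring H L \<phi> \<longleftrightarrow>
     (\<forall>v \<in> verts H. \<phi> v \<in> L v) \<and> (\<forall>u v. u \<rightarrow>\<^bsub>H\<^esub> v \<longrightarrow> \<phi> u \<noteq> \<phi> v)"

definition deletion_set :: "'a pair_pre_digraph \<Rightarrow> ('a \<Rightarrow> nat set) \<Rightarrow> 'a set \<Rightarrow> bool" where
  "deletion_set G L X \<longleftrightarrow>
     X \<subseteq> pverts G \<and> (\<exists>\<phi>. proper_list_coloring (del_verts G X) L \<phi>)"

definition minimum_deletion_set :: "'a pair_pre_digraph \<Rightarrow> ('a \<Rightarrow> nat set) \<Rightarrow> 'a set \<Rightarrow> bool" where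
  "minimum_deletion_set G L X \<longleftrightarrow> is_arg_min card (deletion_set G L) X"

text \<open>Vertices are named \<open>0, \<dots>, n - 1\<close>, so that instances can be written down as machine inputs.\<close>

definition lvd_instance :: "nat \<Rightarrow> nat \<Rightarrow> nat pair_pre_digraph \<Rightarrow> (nat \<Rightarrow> nat set) \<Rightarrow> bool" where
  "lvd_instance q n G L \<longleftrightarrow>
     pair_graph G \<and> pverts G = {..<n} \<and> (\<forall>v < n. L v \<subseteq> {1..q})"


section \<open>Model of computation\<close>

text \<open>
  Algorithms are programs of the first-order functional language F of N. D. Jones
  (\<^emph>\<open>Computability and Complexity from a Programming Perspective\<close>, 1997), here with a local
  definition construct.  Data are binary trees; a program is a finite list of mutually recursive
  function bodies, evaluated call-by-value.  Every evaluation step (variable access, allocation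
  of one pair, projection, emptiness test, local definition, function call) costs one time unit.
  For a fixed program each step is a bounded number of pointer operations, so a random access
  machine executes \<open>t\<close> steps in \<open>O(t)\<close> operations on words of \<open>O(log (t + s))\<close> bits, where \<open>s\<close>
  is the size of the input; there is no arithmetic and no comparison of compound data at unit
  cost.
\<close>

datatype data = Leaf | Node data data

datatype expr =
    Var nat  \<comment> \<open>position in the environment\<close>
  | LeafE
  | NodeE expr expr
  | Fst expr
  | Snd expr
  | Cond expr expr expr  \<comment> \<open>\<^const>\<open>Leaf\<close> counts as false\<close>
  | Local expr expr
  | Call nat "expr list"

type_synonym program = "expr list"

fun left_subtree :: "data \<Rightarrow> data" where
  "left_subtree Leaf = Leaf"
| "left_subtree (Node a b) = a"

fun right_subtree :: "data \<Rightarrow> data" where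
  "right_subtree Leaf = Leaf"
| "right_subtree (Node a b) = b"

text \<open>
  \<open>eval P \<rho> e v t\<close>: in the environment \<open>\<rho>\<close> the expression \<open>e\<close> evaluates to \<open>v\<close> in exactly \<open>t\<close>
  steps.
\<close>

inductive eval :: "program \<Rightarrow> data list \<Rightarrow> expr \<Rightarrow> data \<Rightarrow> nat \<Rightarrow> bool"
  and evals :: "program \<Rightarrow> data list \<Rightarrow> expr list \<Rightarrow> data list \<Rightarrow> nat \<Rightarrow> bool"
  for P :: program
where
  eval_Var: "i < length \<rho> \<Longrightarrow> eval P \<rho> (Var i) (\<rho> ! i) 1"
| eval_LeafE: "eval P \<rho> LeafE Leaf 1"
| eval_NodeE: "\<lbrakk>eval P \<rho> e1 v1 t1; eval P \<rho> e2 v2 t2\<rbrakk>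
    \<Longrightarrow> eval P \<rho> (NodeE e1 e2) (Node v1 v2) (t1 + t2 + 1)"
| eval_Fst: "eval P \<rho> e v t \<Longrightarrow> eval P \<rho> (Fst e) (left_subtree v) (t + 1)"
| eval_Snd: "eval P \<rho> e v t \<Longrightarrow> eval P \<rho> (Snd e) (right_subtree v) (t + 1)"
| eval_Cond_True: "\<lbrakk>eval P \<rho> e1 v1 t1; v1 \<noteq> Leaf; eval P \<rho> e2 v t2\<rbrakk>
    \<Longrightarrow> eval P \<rho> (Cond e1 e2 e3) v (t1 + t2 + 1)"
| eval_Cond_False: "\<lbrakk>eval P \<rho> e1 Leaf t1; eval P \<rho> e3 v t2\<rbrakk>
    \<Longrightarrow> eval P \<rho> (Cond e1 e2 e3) v (t1 + t2 + 1)"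
| eval_Local: "\<lbrakk>eval P \<rho> e1 v1 t1; eval P (v1 # \<rho>) e2 v t2\<rbrakk>
    \<Longrightarrow> eval P \<rho> (Local e1 e2) v (t1 + t2 + 1)"
| eval_Call: "\<lbrakk>evals P \<rho> es vs t1; f < length P; eval P vs (P ! f) v t2\<rbrakk>
    \<Longrightarrow> eval P \<rho> (Call f es) v (t1 + t2 + 1)"
| evals_Nil: "evals P \<rho> [] [] 0"
| evals_Cons: "\<lbrakk>eval P \<rho> e v t1; evals P \<rho> es vs t2\<rbrakk>
    \<Longrightarrow> evals P \<rho> (e # es) (v # vs) (t1 + t2)"

inductive_cases eval_VarE: "eval P \<rho> (Var i) v t"
inductive_cases eval_LeafEE: "eval P \<rho> LeafE v t"
inductive_cases eval_NodeEE: "eval P \<rho> (NodeE e1 e2) v t"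
inductive_cases eval_FstE: "eval P \<rho> (Fst e) v t"
inductive_cases eval_SndE: "eval P \<rho> (Snd e) v t"
inductive_cases eval_CondE: "eval P \<rho> (Cond e1 e2 e3) v t"
inductive_cases eval_LocalE: "eval P \<rho> (Local e1 e2) v t"
inductive_cases eval_CallE: "eval P \<rho> (Call f es) v t"
inductive_cases evals_NilE: "evals P \<rho> [] vs t"
inductive_cases evals_ConsE: "evals P \<rho> (e # es) vs t"

lemma eval_deterministic:
  "eval P \<rho> e v t \<Longrightarrow> eval P \<rho> e v' t' \<Longrightarrow> v' = v \<and> t' = t"
  "evals P \<rho> es vs t \<Longrightarrow> evals P \<rho> es vs' t' \<Longrightarrow> vs' = vs \<and> t' = t"
proof (induction arbitrary: v' t' and vs' t' rule: eval_evals.inducts)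
  case eval_Var
  from eval_Var.prems show ?case by (rule eval_VarE) simp
next
  case eval_LeafE
  from eval_LeafE.prems show ?case by (rule eval_LeafEE) simp
next
  case eval_NodeE
  from eval_NodeE.prems show ?case by (rule eval_NodeEE) (metis Suc_eq_plus1 eval_NodeE.IH)
next
  case eval_Fst
  from eval_Fst.prems show ?case by (rule eval_FstE) (metis Suc_eq_plus1 eval_Fst.IH)
next
  case eval_Snd
  from eval_Snd.prems show ?case by (rule eval_SndE) (metis Suc_eq_plus1 eval_Snd.IH)
next
  case eval_Cond_True
  from eval_Cond_True.prems show ?case
    by (rule eval_CondE) (metis Suc_eq_plus1 eval_Cond_True.IH eval_Cond_True.hyps)+
next
  case eval_Cond_False
  from eval_Cond_False.prems show ?case
    by (rule eval_CondE) (metis Suc_eq_plus1 eval_Cond_False.IH)+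
next
  case eval_Local
  from eval_Local.prems show ?case
    by (rule eval_LocalE) (metis Suc_eq_plus1 eval_Local.IH)
next
  case eval_Call
  from eval_Call.prems show ?case
    by (rule eval_CallE) (metis Suc_eq_plus1 eval_Call.IH)
next
  case evals_Nil
  from evals_Nil.prems show ?case by (rule evals_NilE) simp
next
  case evals_Cons
  from evals_Cons.prems show ?case by (rule evals_ConsE) (metis Suc_eq_plus1 evals_Cons.IH)
qed

text \<open>Function \<open>0\<close> is the main function; it takes the input as its only argument.\<close>

definition runs :: "program \<Rightarrow> data \<Rightarrow> data \<Rightarrow> nat \<Rightarrow> bool" where
  "runs P x y t \<longleftrightarrow> P \<noteq> [] \<and> eval P [x] (P ! 0) y t"


section \<open>Encoding of inputs and outputs\<close>

definition enc_bool :: "bool \<Rightarrow> data" where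
  "enc_bool b = (if b then Node Leaf Leaf else Leaf)"

definition enc_list :: "('a \<Rightarrow> data) \<Rightarrow> 'a list \<Rightarrow> data" where
  "enc_list enc xs = foldr (\<lambda>x. Node (enc x)) xs Leaf"

definition enc_vertex_set :: "nat \<Rightarrow> nat set \<Rightarrow> data" where
  "enc_vertex_set n X = enc_list (\<lambda>v. enc_bool (v \<in> X)) [0..<n]"

definition enc_graph :: "nat \<Rightarrow> nat pair_pre_digraph \<Rightarrow> data" where
  "enc_graph n G =
     enc_list (\<lambda>u. enc_list (\<lambda>v. enc_bool ((u, v) \<in> parcs G)) [0..<n]) [0..<n]"

definition enc_lists :: "nat \<Rightarrow> nat \<Rightarrow> (nat \<Rightarrow> nat set) \<Rightarrow> data" where
  "enc_lists q n L =
     enc_list (\<lambda>v. enc_list (\<lambda>c. enc_bool (c \<in> L v)) [1..<Suc q]) [0..<n]"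

definition enc_input ::
    "nat \<Rightarrow> nat \<Rightarrow> nat pair_pre_digraph \<Rightarrow> (nat \<Rightarrow> nat set) \<Rightarrow> nat set \<Rightarrow> data" where
  "enc_input q n G L Q = Node (enc_graph n G) (Node (enc_lists q n L) (enc_vertex_set n Q))"

end

theory Submission
  imports Defs "HOL-Library.Multiset"
begin

text \<open>
  Branch on the assignments of colours, or of the value \<open>0\<close> for ``deleted'', to the hub.  Deleting a
  hub vertex \<open>v\<close> costs one and never hurts a component.  So if giving \<open>v\<close> the colour \<open>a\<close> costs some
  component \<open>C\<close> at least one more than deleting \<open>v\<close> does, for some assignment \<open>b\<close> of the other
  neighbours of \<open>C\<close> in the hub, then the joint assignment of \<open>a\<close> and \<open>b\<close> is dominated by deleting \<open>v\<close>
  and can be skipped: a branching on \<open>k \<le> \<delta> + 1\<close> hub vertices has at most \<open>(q + 1)^k - 1\<close> branches.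
  If this happens for no component, then \<open>a\<close> is free of charge and \<open>v\<close> receives it without any
  branching.  Two adjacent undecided hub vertices cannot share a colour, which saves a branch as
  well.  Hence the search tree has \<open>O(p x^p)\<close> nodes, where \<open>x^D = (q + 1)^D - 1\<close> for
  \<open>D = max 2 (\<delta> + 1)\<close>, and the work in each node is polynomial because components have at most \<open>\<sigma>\<close>
  vertices.
\<close>

section \<open>The program\<close>

text \<open>Costs are integers, so failing to cost a component at least one more than deletion means
  costing it no more at all. One test therefore serves both rules: a success removes a joint
  assignment by an exchange inside \<open>C\<close> and \<open>v\<close>; a failure for all
  components and all assignments of their other neighbours lets any solution be changed to give
  \<open>v\<close> the colour, each component being repaired on its own. Only the first colour in
  the list of \<open>v\<close> is tested, since a success has to save a single branch only and a
  failure settles \<open>v\<close>. The comparison is exact because all undecided neighbours of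
  \<open>C\<close> are enumerated: once they and the decided vertices are fixed, nothing else
  depends on how \<open>C\<close> is completed. A branching on \<open>k < D\<close> vertices saves a
  larger fraction of its branches than one on \<open>D\<close>, so the same \<open>x\<close> bounds
  them all. As \<open>x\<close> depends on \<open>q\<close> and \<delta> only, so does \<epsilon>,
  while \<sigma> enters the polynomial factor. The program contains none of the three: it reads the
  colours off the lists and the components off the graph.\<close>

text \<open>
  A body finds its arguments at positions \<open>0, 1, \<dots>\<close> of the environment, in the order of the
  abbreviation that calls it.  Numbers are unary.  A vertex is the tree of its number, its row of the
  adjacency matrix and its options, so that the graph need not be passed around.
\<close>

abbreviation TrueE :: expr where "TrueE \<equiv> NodeE LeafE LeafE"
abbreviation nthE :: "expr \<Rightarrow> expr \<Rightarrow> expr" where "nthE xs i \<equiv> Call (Suc 0) [xs, i]"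
abbreviation eqE :: "expr \<Rightarrow> expr \<Rightarrow> expr" where "eqE a b \<equiv> Call 2 [a, b]"
abbreviation leE :: "expr \<Rightarrow> expr \<Rightarrow> expr" where "leE a b \<equiv> Call 3 [a, b]"
abbreviation adjE :: "expr \<Rightarrow> expr \<Rightarrow> expr" where "adjE x y \<equiv> nthE (Fst (Snd x)) (Fst y)"
abbreviation confE :: "expr \<Rightarrow> expr \<Rightarrow> expr \<Rightarrow> expr" where "confE r v c \<equiv> Call 4 [r, v, c]"
abbreviation ext1E :: "expr \<Rightarrow> expr \<Rightarrow> expr \<Rightarrow> expr \<Rightarrow> expr" where
  "ext1E cs v r rest \<equiv> Call 5 [cs, v, r, rest]"
abbreviation extlE :: "expr \<Rightarrow> expr \<Rightarrow> expr" where "extlE rs v \<equiv> Call 6 [rs, v]"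
abbreviation extE :: "expr \<Rightarrow> expr \<Rightarrow> expr" where "extE s W \<equiv> Call 7 [s, W]"
abbreviation zerosE :: "expr \<Rightarrow> expr" where "zerosE s \<equiv> Call 8 [s]"
abbreviation aminE :: "expr \<Rightarrow> expr" where "aminE rs \<equiv> Call 9 [rs]"
abbreviation bestE :: "expr \<Rightarrow> expr \<Rightarrow> expr" where "bestE s W \<equiv> aminE (extE s W)"
abbreviation domE :: "expr \<Rightarrow> expr \<Rightarrow> expr" where "domE r C \<equiv> Call 10 [r, C]"
abbreviation fdomE :: "expr \<Rightarrow> expr \<Rightarrow> expr" where "fdomE rs C \<equiv> Call 11 [rs, C]"
abbreviation usefulE :: "expr \<Rightarrow> expr \<Rightarrow> expr \<Rightarrow> expr" where "usefulE bs v C \<equiv> Call 12 [bs, v, C]"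
abbreviation adjanyE :: "expr \<Rightarrow> expr \<Rightarrow> expr" where "adjanyE y C \<equiv> Call 13 [y, C]"
abbreviation partE :: "expr \<Rightarrow> expr \<Rightarrow> expr" where "partE H C \<equiv> Call 14 [H, C]"
abbreviation appendE :: "expr \<Rightarrow> expr \<Rightarrow> expr" where "appendE xs ys \<equiv> Call 15 [xs, ys]"
abbreviation findE :: "expr \<Rightarrow> expr \<Rightarrow> expr \<Rightarrow> expr \<Rightarrow> expr" where "findE Cs s v H \<equiv> Call 16 [Cs, s, v, H]"
abbreviation solveE :: "expr \<Rightarrow> expr \<Rightarrow> expr \<Rightarrow> expr" where "solveE Cs s H \<equiv> Call 17 [Cs, s, H]"
abbreviation solvelE :: "expr \<Rightarrow> expr \<Rightarrow> expr \<Rightarrow> expr" where "solvelE Cs bs H \<equiv> Call 18 [Cs, bs, H]"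
abbreviation finishE :: "expr \<Rightarrow> expr \<Rightarrow> expr" where "finishE Cs s \<equiv> Call 19 [Cs, s]"
abbreviation addE :: "expr \<Rightarrow> expr \<Rightarrow> expr" where "addE w Cs \<equiv> Call 20 [w, Cs]"
abbreviation partsE :: "expr \<Rightarrow> expr" where "partsE W \<equiv> Call 21 [W]"
abbreviation optsE :: "expr \<Rightarrow> expr \<Rightarrow> expr" where "optsE l c \<equiv> Call 22 [l, c]"
abbreviation splitE :: "expr \<Rightarrow> expr \<Rightarrow> expr \<Rightarrow> expr \<Rightarrow> expr" where "splitE g l h i \<equiv> Call 23 [g, l, h, i]"
abbreviation delE :: "expr \<Rightarrow> expr \<Rightarrow> expr" where "delE s i \<equiv> Call 24 [s, i]"
abbreviation outE :: "expr \<Rightarrow> expr \<Rightarrow> expr \<Rightarrow> expr" where "outE g i s \<equiv> Call 25 [g, i, s]"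

definition main_body :: expr where
  "main_body =
    Local (splitE (Fst (Var 0)) (Fst (Snd (Var 0))) (Snd (Snd (Var 0))) LeafE)
      (outE (Fst (Var 1)) LeafE
        (solveE (partsE (Snd (Var 0))) LeafE (Fst (Var 0))))"

definition nth_body :: expr where
  "nth_body =
    Cond (Var 0) (Cond (Var 1) (nthE (Snd (Var 0)) (Snd (Var 1))) (Fst (Var 0))) LeafE"

definition eq_body :: expr where
  "eq_body =
    Cond (Var 0) (Cond (Var 1) (eqE (Snd (Var 0)) (Snd (Var 1))) LeafE)
      (Cond (Var 1) LeafE TrueE)"

definition le_body :: expr where
  "le_body =
    Cond (Var 0) (Cond (Var 1) (leE (Snd (Var 0)) (Snd (Var 1))) LeafE) TrueE"

definition conf_body :: expr where
  "conf_body =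
    Cond (Var 0)
      (Cond (Var 2)
        (Cond (adjE (Var 1) (Fst (Fst (Var 0))))
          (Cond (eqE (Var 2) (Snd (Fst (Var 0)))) TrueE (confE (Snd (Var 0)) (Var 1) (Var 2)))
          (confE (Snd (Var 0)) (Var 1) (Var 2)))
        LeafE)
      LeafE"

definition ext1_body :: expr where
  "ext1_body =
    Cond (Var 0)
      (Local (ext1E (Snd (Var 0)) (Var 1) (Var 2) (Var 3))
        (Cond (confE (Var 3) (Var 2) (Fst (Var 1)))
          (Var 0)
          (NodeE (NodeE (NodeE (Var 2) (Fst (Var 1))) (Var 3)) (Var 0))))
      (Var 3)"

definition extl_body :: expr where
  "extl_body =
    Cond (Var 0)
      (ext1E (Snd (Snd (Var 1))) (Var 1) (Fst (Var 0)) (extlE (Snd (Var 0)) (Var 1)))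
      LeafE"

definition ext_body :: expr where
  "ext_body =
    Cond (Var 1) (extlE (extE (Var 0) (Snd (Var 1))) (Fst (Var 1))) (NodeE (Var 0) LeafE)"

definition zeros_body :: expr where
  "zeros_body =
    Cond (Var 0)
      (Cond (Snd (Fst (Var 0))) (zerosE (Snd (Var 0))) (NodeE LeafE (zerosE (Snd (Var 0)))))
      LeafE"

definition amin_body :: expr where
  "amin_body =
    Cond (Snd (Var 0))
      (Local (aminE (Snd (Var 0)))
        (Cond (leE (zerosE (Fst (Var 1))) (zerosE (Var 0))) (Fst (Var 1)) (Var 0)))
      (Fst (Var 0))"

definition dom_body :: expr where
  "dom_body =
    Cond (Snd (Fst (Var 0)))
      (leE (zerosE (bestE (NodeE (NodeE (Fst (Fst (Var 0))) LeafE) (Snd (Var 0))) (Var 1)))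
           (zerosE (bestE (Var 0) (Var 1))))
      LeafE"

definition fdom_body :: expr where
  "fdom_body =
    Cond (Var 0)
      (Cond (domE (Fst (Var 0)) (Var 1))
        (fdomE (Snd (Var 0)) (Var 1))
        (NodeE (Fst (Var 0)) (fdomE (Snd (Var 0)) (Var 1))))
      LeafE"

definition useful_body :: expr where
  "useful_body =
    Cond (Var 0)
      (Cond (confE (Fst (Var 0)) (Var 1) (Fst (Snd (Snd (Var 1)))))
        TrueE
        (Cond (domE (NodeE (NodeE (Var 1) (Fst (Snd (Snd (Var 1))))) (Fst (Var 0))) (Var 2))
          TrueE
          (usefulE (Snd (Var 0)) (Var 1) (Var 2))))
      LeafE"

definition adjany_body :: expr where
  "adjany_body =
    Cond (Var 1)
      (Cond (adjE (Var 0) (Fst (Var 1))) TrueE (adjanyE (Var 0) (Snd (Var 1))))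
      LeafE"

definition part_body :: expr where
  "part_body =
    Cond (Var 0)
      (Local (partE (Snd (Var 0)) (Var 1))
        (Cond (adjanyE (Fst (Var 1)) (Var 2))
          (NodeE (NodeE (Fst (Var 1)) (Fst (Var 0))) (Snd (Var 0)))
          (NodeE (Fst (Var 0)) (NodeE (Fst (Var 1)) (Snd (Var 0))))))
      (NodeE LeafE LeafE)"

definition append_body :: expr where
  "append_body =
    Cond (Var 0) (NodeE (Fst (Var 0)) (appendE (Snd (Var 0)) (Var 1))) (Var 1)"

definition find_body :: expr where
  "find_body =
    Cond (Var 0)
      (Cond (usefulE (extE (Var 1) (Fst (partE (Var 3) (Fst (Var 0))))) (Var 2) (Fst (Var 0)))
        (Var 0)
        (findE (Snd (Var 0)) (Var 1) (Var 2) (Var 3)))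
      LeafE"

text \<open>Each \<open>Local\<close> shifts the environment by one: the arguments are
  \<open>Var 1\<close> to \<open>Var 3\<close> under the partition by the neighbours of
  \<open>v\<close>, \<open>Var 2\<close> to \<open>Var 4\<close> under the result of
  \<open>findE\<close>, and \<open>Var 3\<close> to \<open>Var 5\<close> under the partition by the
  component found.\<close>

definition solve_body :: expr where
  "solve_body =
    Cond (Var 2)
      (Local (partE (Snd (Var 2)) (NodeE (Fst (Var 2)) LeafE))
        (Cond (Fst (Var 0))
          (aminE (solvelE (Var 1)
            (extE (Var 2) (NodeE (Fst (Var 3)) (NodeE (Fst (Fst (Var 0))) LeafE)))
            (appendE (Snd (Fst (Var 0))) (Snd (Var 0)))))
          (Local (findE (Var 1) (Var 2) (Fst (Var 3)) (Snd (Var 3)))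
            (Cond (Var 0)
              (Local (partE (Snd (Var 4)) (Fst (Var 0)))
                (aminE (solvelE (Var 3)
                  (fdomE (extE (Var 4) (NodeE (Fst (Var 5)) (Fst (Var 0)))) (Fst (Var 1)))
                  (Snd (Var 0)))))
              (solveE (Var 2)
                (NodeE (NodeE (Fst (Var 4)) (Fst (Snd (Snd (Fst (Var 4)))))) (Var 3))
                (Snd (Var 4)))))))
      (finishE (Var 0) (Var 1))"

definition solvel_body :: expr where
  "solvel_body =
    Cond (Var 1)
      (NodeE (solveE (Var 0) (Fst (Var 1)) (Var 2)) (solvelE (Var 0) (Snd (Var 1)) (Var 2)))
      LeafE"

definition finish_body :: expr where
  "finish_body =
    Cond (Var 0) (finishE (Snd (Var 0)) (bestE (Var 1) (Fst (Var 0)))) (Var 1)"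

definition add_body :: expr where
  "add_body =
    Cond (Var 1)
      (Local (addE (Var 0) (Snd (Var 1)))
        (Cond (adjanyE (Var 1) (Fst (Var 2)))
          (NodeE (appendE (Fst (Var 2)) (Fst (Var 0))) (Snd (Var 0)))
          (NodeE (Fst (Var 0)) (NodeE (Fst (Var 2)) (Snd (Var 0))))))
      (NodeE (NodeE (Var 0) LeafE) LeafE)"

definition parts_body :: expr where
  "parts_body =
    Cond (Var 0) (addE (Fst (Var 0)) (partsE (Snd (Var 0)))) (NodeE LeafE LeafE)"

definition opts_body :: expr where
  "opts_body =
    Cond (Var 0)
      (Local (optsE (Snd (Var 0)) (NodeE LeafE (Var 1)))
        (Cond (Fst (Var 1)) (NodeE (Var 2) (Var 0)) (Var 0)))
      (NodeE LeafE LeafE)"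

text \<open>\<open>TrueE\<close> doubles here as the unary number 1, the first colour.\<close>

definition split_body :: expr where
  "split_body =
    Cond (Var 0)
      (Local (splitE (Snd (Var 0)) (Snd (Var 1)) (Snd (Var 2)) (NodeE LeafE (Var 3)))
        (Local (NodeE (Var 4) (NodeE (Fst (Var 1)) (optsE (Fst (Var 2)) TrueE)))
          (Cond (Fst (Var 4))
            (NodeE (NodeE (Var 0) (Fst (Var 1))) (Snd (Var 1)))
            (NodeE (Fst (Var 1)) (NodeE (Var 0) (Snd (Var 1)))))))
      (NodeE LeafE LeafE)"

definition del_body :: expr where
  "del_body =
    Cond (Var 0)
      (Cond (Snd (Fst (Var 0)))
        (delE (Snd (Var 0)) (Var 1))
        (Cond (eqE (Var 1) (Fst (Fst (Fst (Var 0))))) TrueE (delE (Snd (Var 0)) (Var 1))))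
      LeafE"

definition out_body :: expr where
  "out_body =
    Cond (Var 0)
      (NodeE (delE (Var 2) (Var 1)) (outE (Snd (Var 0)) (NodeE LeafE (Var 1)) (Var 2)))
      LeafE"

definition prog :: program where
  "prog =
    [main_body, nth_body, eq_body, le_body, conf_body, ext1_body, extl_body, ext_body,
     zeros_body, amin_body, dom_body, fdom_body, useful_body, adjany_body, part_body,
     append_body, find_body, solve_body, solvel_body, finish_body, add_body, parts_body,
     opts_body, split_body, del_body, out_body]"

lemma length_prog [simp]: "length prog = 26"
  by (simp add: prog_def)

lemma prog_nth [simp]:
  "prog ! 0 = main_body"
  "prog ! Suc 0 = nth_body"
  "prog ! 2 = eq_body"
  "prog ! 3 = le_body"
  "prog ! 4 = conf_body"
  "prog ! 5 = ext1_body"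
  "prog ! 6 = extl_body"
  "prog ! 7 = ext_body"
  "prog ! 8 = zeros_body"
  "prog ! 9 = amin_body"
  "prog ! 10 = dom_body"
  "prog ! 11 = fdom_body"
  "prog ! 12 = useful_body"
  "prog ! 13 = adjany_body"
  "prog ! 14 = part_body"
  "prog ! 15 = append_body"
  "prog ! 16 = find_body"
  "prog ! 17 = solve_body"
  "prog ! 18 = solvel_body"
  "prog ! 19 = finish_body"
  "prog ! 20 = add_body"
  "prog ! 21 = parts_body"
  "prog ! 22 = opts_body"
  "prog ! 23 = split_body"
  "prog ! 24 = del_body"
  "prog ! 25 = out_body"
  by (simp_all add: prog_def)

section \<open>Reasoning about running times\<close>

text \<open>Evaluation as a predicate transformer: value and cost of a body are computed together by
  rewriting, so that exact step counts never have to be guessed as witnesses.\<close>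

definition wp :: "data list \<Rightarrow> expr \<Rightarrow> (data \<Rightarrow> nat \<Rightarrow> bool) \<Rightarrow> bool" where
  "wp \<rho> e \<Phi> \<longleftrightarrow> (\<exists>v t. eval prog \<rho> e v t \<and> \<Phi> v t)"

definition wps :: "data list \<Rightarrow> expr list \<Rightarrow> (data list \<Rightarrow> nat \<Rightarrow> bool) \<Rightarrow> bool" where
  "wps \<rho> es \<Phi> \<longleftrightarrow> (\<exists>vs t. evals prog \<rho> es vs t \<and> \<Phi> vs t)"

definition callp :: "nat \<Rightarrow> data list \<Rightarrow> (data \<Rightarrow> nat \<Rightarrow> bool) \<Rightarrow> bool" where
  "callp f vs \<Phi> \<longleftrightarrow> f < length prog \<and> wp vs (prog ! f) \<Phi>"

text \<open>\<open>B\<close> is an upper bound, unlike the exact cost in \<open>eval\<close>; bounds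
  of callees can then be weakened and added up regardless of the branch that a conditional
  takes.\<close>

definition fn :: "nat \<Rightarrow> data list \<Rightarrow> data \<Rightarrow> nat \<Rightarrow> bool" where
  "fn f vs v B \<longleftrightarrow> callp f vs (\<lambda>w t. w = v \<and> t \<le> B)"

inductive_simps eval_iffs:
  "eval P \<rho> (Var i) v t" "eval P \<rho> LeafE v t" "eval P \<rho> (NodeE e1 e2) v t"
  "eval P \<rho> (Fst e1) v t" "eval P \<rho> (Snd e1) v t" "eval P \<rho> (Cond e1 e2 e3) v t"
  "eval P \<rho> (Local e1 e2) v t" "eval P \<rho> (Call f es) v t"
  "evals P \<rho> [] vs t" "evals P \<rho> (e1 # es) vs t"

lemma wp_Var [simp]:
  "wp \<rho> (Var i) \<Phi> \<longleftrightarrow> i < length \<rho> \<and> \<Phi> (\<rho> ! i) 1"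
  unfolding wp_def wps_def callp_def eval_iffs by auto

lemma wp_LeafE [simp]:
  "wp \<rho> LeafE \<Phi> \<longleftrightarrow> \<Phi> Leaf 1"
  unfolding wp_def wps_def callp_def eval_iffs by auto

lemma wp_NodeE [simp]:
  "wp \<rho> (NodeE e1 e2) \<Phi> \<longleftrightarrow> wp \<rho> e1 (\<lambda>v t. wp \<rho> e2 (\<lambda>w u. \<Phi> (Node v w) (t + u + 1)))"
  unfolding wp_def wps_def callp_def eval_iffs by (auto; blast)

lemma wp_Fst [simp]:
  "wp \<rho> (Fst e1) \<Phi> \<longleftrightarrow> wp \<rho> e1 (\<lambda>v t. \<Phi> (left_subtree v) (t + 1))"
  unfolding wp_def wps_def callp_def eval_iffs by auto

lemma wp_Snd [simp]:
  "wp \<rho> (Snd e1) \<Phi> \<longleftrightarrow> wp \<rho> e1 (\<lambda>v t. \<Phi> (right_subtree v) (t + 1))"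
  unfolding wp_def wps_def callp_def eval_iffs by auto

lemma wp_Cond [simp]:
  "wp \<rho> (Cond e1 e2 e3) \<Phi> \<longleftrightarrow>
     wp \<rho> e1 (\<lambda>v t. if v = Leaf then wp \<rho> e3 (\<lambda>w u. \<Phi> w (t + u + 1))
                             else wp \<rho> e2 (\<lambda>w u. \<Phi> w (t + u + 1)))"
  unfolding wp_def wps_def callp_def eval_iffs if_bool_eq_disj by (simp; blast)

lemma wp_Local [simp]:
  "wp \<rho> (Local e1 e2) \<Phi> \<longleftrightarrow> wp \<rho> e1 (\<lambda>v t. wp (v # \<rho>) e2 (\<lambda>w u. \<Phi> w (t + u + 1)))"
  unfolding wp_def wps_def callp_def eval_iffs by (auto; blast)

lemma wp_Call [simp]:
  "wp \<rho> (Call f es) \<Phi> \<longleftrightarrow> wps \<rho> es (\<lambda>vs t. callp f vs (\<lambda>w u. \<Phi> w (t + u + 1)))"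
  unfolding wp_def wps_def callp_def eval_iffs by (auto; blast)

lemma wp_Nil [simp]:
  "wps \<rho> [] \<Psi> \<longleftrightarrow> \<Psi> [] 0"
  unfolding wp_def wps_def callp_def eval_iffs by auto

lemma wp_Cons [simp]:
  "wps \<rho> (e # es) \<Psi> \<longleftrightarrow> wp \<rho> e (\<lambda>v t. wps \<rho> es (\<lambda>vs u. \<Psi> (v # vs) (t + u)))"
  unfolding wp_def wps_def callp_def eval_iffs by (auto; blast)

lemma fn_call: "fn f vs v B \<Longrightarrow> (\<And>t. t \<le> B \<Longrightarrow> \<Phi> v t) \<Longrightarrow> callp f vs \<Phi>"
  unfolding fn_def callp_def wp_def by blast

lemma fn_mono: "fn f vs v B \<Longrightarrow> B \<le> B' \<Longrightarrow> fn f vs v B'"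
  unfolding fn_def callp_def wp_def by force

primrec enc_nat :: "nat \<Rightarrow> data" where
  "enc_nat 0 = Leaf"
| "enc_nat (Suc k) = Node Leaf (enc_nat k)"

lemma enc_nat_eq_Leaf [simp]: "enc_nat k = Leaf \<longleftrightarrow> k = 0"
  by (cases k) auto

lemma enc_bool_eq_Leaf [simp]: "enc_bool b = Leaf \<longleftrightarrow> \<not> b"
  by (simp add: enc_bool_def)

lemma enc_bool_simps [simp]: "enc_bool True = Node Leaf Leaf" "enc_bool False = Leaf"
  by (simp_all add: enc_bool_def)

lemma enc_list_simps [simp]:
  "enc_list f [] = Leaf"
  "enc_list f (x # xs) = Node (f x) (enc_list f xs)"
  by (simp_all add: enc_list_def)

lemma enc_list_eq_Leaf [simp]: "enc_list f xs = Leaf \<longleftrightarrow> xs = []"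
  by (cases xs) auto

lemma fn_body:
  "fn f vs v B \<longleftrightarrow> f < length prog \<and> wp vs (prog ! f) (\<lambda>w t. w = v \<and> t \<le> B)"
  by (simp add: fn_def callp_def)

lemmas body = fn_body main_body_def nth_body_def eq_body_def le_body_def conf_body_def
  ext1_body_def extl_body_def ext_body_def zeros_body_def amin_body_def dom_body_def
  fdom_body_def useful_body_def adjany_body_def part_body_def append_body_def find_body_def
  solve_body_def solvel_body_def finish_body_def add_body_def parts_body_def opts_body_def
  split_body_def del_body_def out_body_def

section \<open>The algorithm\<close>

text \<open>A partial assignment is a list of pairs of a vertex and a colour; colour \<open>0\<close> means that the
  vertex is deleted.  Below, \<open>Opt v\<close> lists the allowed colours of \<open>v\<close> and then \<open>0\<close>.\<close>

fun zeros :: "(nat \<times> nat) list \<Rightarrow> nat" where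
  "zeros [] = 0"
| "zeros (p # s) = (if snd p = 0 then Suc (zeros s) else zeros s)"

fun amin :: "(nat \<times> nat) list list \<Rightarrow> (nat \<times> nat) list" where
  "amin [] = []"
| "amin [r] = r"
| "amin (r # rs) = (if zeros r \<le> zeros (amin rs) then r else amin rs)"

text \<open>For the termination of \<open>solve\<close>: in the edge case the recursive call
  receives the neighbours of \<open>v\<close> except \<open>u\<close>, together with the
  non-neighbours.\<close>

lemma length_filter_Cons_compl:
  assumes "filter P H = u # S"
  shows "length S + length (filter (\<lambda>y. \<not> P y) H) < Suc (length H)"
  using sum_length_filter_compl[of P H] assms by simp

text \<open>The constants in the time bounds are generous round numbers.  Throughout, \<open>m\<close> bounds the length
  of assignments, \<open>k\<close> the size of components and \<open>d\<close> the number of their neighbours in the hub.\<close>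

definition conf_time :: "nat \<Rightarrow> nat \<Rightarrow> nat \<Rightarrow> nat" where
  "conf_time q n m = (m + 1) * (20 * n + 20 * q + 100) + 50"

definition extl_time :: "nat \<Rightarrow> nat \<Rightarrow> nat \<Rightarrow> nat" where
  "extl_time q n m = (q + 2) * conf_time q n m + 50"

definition ext_time :: "nat \<Rightarrow> nat \<Rightarrow> nat \<Rightarrow> nat \<Rightarrow> nat" where
  "ext_time q n k m = (k + 1) * (((q + 1) ^ k + 1) * extl_time q n m + 50)"

definition amin_time :: "nat \<Rightarrow> nat" where
  "amin_time m = 60 * m + 100"

definition best_time :: "nat \<Rightarrow> nat \<Rightarrow> nat \<Rightarrow> nat \<Rightarrow> nat" where
  "best_time q n k m = ext_time q n k m + (q + 1) ^ k * amin_time m"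

definition dom_time :: "nat \<Rightarrow> nat \<Rightarrow> nat \<Rightarrow> nat \<Rightarrow> nat" where
  "dom_time q n k m = 2 * best_time q n k m + 60 * m + 200"

definition part_time :: "nat \<Rightarrow> nat \<Rightarrow> nat \<Rightarrow> nat" where
  "part_time n k h = (h + 1) * ((k + 1) * (20 * n + 50) + 50)"

definition find_time :: "nat \<Rightarrow> nat \<Rightarrow> nat \<Rightarrow> nat \<Rightarrow> nat \<Rightarrow> nat \<Rightarrow> nat" where
  "find_time q n d k h m = part_time n k h + ext_time q n d m
     + ((q + 1) ^ d + 1) * (conf_time q n m + dom_time q n k m + 100) + 100"

text \<open>What one call of \<open>solve\<close> spends outside its recursive calls. The number
  \<open>max 2 (d + 1)\<close> is the most hub vertices decided in one branching: two for an edge,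
  one plus the undecided neighbours for a component.\<close>

definition node_time :: "nat \<Rightarrow> nat \<Rightarrow> nat \<Rightarrow> nat \<Rightarrow> nat \<Rightarrow> nat \<Rightarrow> nat \<Rightarrow> nat" where
  "node_time q n d k p m c =
     2 * part_time n (k + 1) p + 20 * p + ext_time q n (max 2 (d + 1)) m
     + (c + 1) * find_time q n d k p m
     + ((q + 1) ^ max 2 (d + 1) + 1) * (dom_time q n k m + amin_time m + 100)
     + (c + 1) * (best_time q n k m + 50) + 300"

text \<open>By \<open>hd_Opt\<close> the first option is a real colour unless there is none, so a
  vertex forced to its first option is deleted only when deletion is its only option.\<close>

locale instance_data =
  fixes q n :: nat and E :: "nat \<Rightarrow> nat \<Rightarrow> bool" and Opt :: "nat \<Rightarrow> nat list"
  assumes E_sym: "E u v \<Longrightarrow> E v u"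
    and E_irrefl: "\<not> E v v"
    and E_less: "E u v \<Longrightarrow> v < n"
    and Opt_distinct: "distinct (Opt v)"
    and Opt_le: "c \<in> set (Opt v) \<Longrightarrow> c \<le> q"
    and zero_Opt: "0 \<in> set (Opt v)"
    and hd_Opt: "hd (Opt v) = 0 \<Longrightarrow> set (Opt v) = {0}"
begin

definition conf :: "(nat \<times> nat) list \<Rightarrow> nat \<Rightarrow> nat \<Rightarrow> bool" where
  "conf r v c \<longleftrightarrow> c \<noteq> 0 \<and> (\<exists>u. (u, c) \<in> set r \<and> E v u)"

primrec ext :: "(nat \<times> nat) list \<Rightarrow> nat list \<Rightarrow> (nat \<times> nat) list list" where
  "ext s [] = [s]"
| "ext s (v # W) =
     concat (map (\<lambda>r. map (\<lambda>c. (v, c) # r) (filter (\<lambda>c. \<not> conf r v c) (Opt v))) (ext s W))"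

definition best :: "(nat \<times> nat) list \<Rightarrow> nat list \<Rightarrow> (nat \<times> nat) list" where
  "best s W = amin (ext s W)"

text \<open>The head of \<open>r\<close> is the assignment of the branching vertex.  Its own deletion is counted by
  \<^const>\<open>zeros\<close>, so \<open>\<le>\<close> says that colouring it costs \<open>C\<close> at least one deletion more.\<close>

definition dominated :: "nat list \<Rightarrow> (nat \<times> nat) list \<Rightarrow> bool" where
  "dominated C r \<longleftrightarrow> snd (hd r) \<noteq> 0 \<and>
     zeros (best ((fst (hd r), 0) # tl r) C) \<le> zeros (best r C)"

text \<open>A certificate for a lost branch: a single assignment \<open>b\<close> under which the
  first colour is illegal or dominated already makes the branching strictly smaller. Without one,
  the colour is safe as far as \<open>C\<close> is concerned.\<close>

definition useful :: "nat \<Rightarrow> nat list \<Rightarrow> (nat \<times> nat) list list \<Rightarrow> bool" where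
  "useful v C bs \<longleftrightarrow>
     (\<exists>b \<in> set bs. conf b v (hd (Opt v)) \<or> dominated C ((v, hd (Opt v)) # b))"

definition touches :: "nat list \<Rightarrow> nat \<Rightarrow> bool" where
  "touches C y \<longleftrightarrow> (\<exists>x \<in> set C. E y x)"

text \<open>A suffix rather than a component, so that an empty result means failure: the empty part
  is itself encoded as \<open>Leaf\<close> and must remain distinguishable from it when
  found.\<close>

definition pieces :: "nat list list \<Rightarrow> (nat \<times> nat) list \<Rightarrow> nat \<Rightarrow> nat list \<Rightarrow> nat list list" where
  "pieces Cs s v H = dropWhile (\<lambda>C. \<not> useful v C (ext s (filter (touches C) H))) Cs"

primrec finish :: "nat list list \<Rightarrow> (nat \<times> nat) list \<Rightarrow> (nat \<times> nat) list" where
  "finish [] s = s"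
| "finish (C # Cs) s = finish Cs (best s C)"

text \<open>Components are inspected only when \<open>v\<close> has no undecided neighbour in the
  hub. Hence a forced colour can clash only with decided vertices or inside components, which is
  what \<open>pieces\<close> checks.\<close>

function solve :: "nat list list \<Rightarrow> (nat \<times> nat) list \<Rightarrow> nat list \<Rightarrow> (nat \<times> nat) list" where
  "solve Cs s [] = finish Cs s"
| "solve Cs s (v # H) =
    (case filter (E v) H of
       u # S \<Rightarrow> amin (map (\<lambda>b. solve Cs b (S @ filter (\<lambda>y. \<not> E v y) H)) (ext s [v, u]))
     | [] \<Rightarrow>
       (case pieces Cs s v H of
          C # D \<Rightarrow> amin (map (\<lambda>b. solve Cs b (filter (\<lambda>y. \<not> touches C y) H))
            (filter (\<lambda>r. \<not> dominated C r) (ext s (v # filter (touches C) H))))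
        | [] \<Rightarrow> solve Cs ((v, hd (Opt v)) # s) H))"
  by pat_completeness auto
termination
  by (relation "measure (\<lambda>(Cs, s, H). length H)")
     (auto simp: le_imp_less_Suc intro: length_filter_Cons_compl)

section \<open>Values and times of the program functions\<close>

definition encv :: "nat \<Rightarrow> data" where
  "encv v = Node (enc_nat v)
     (Node (enc_list (\<lambda>u. enc_bool (E v u)) [0..<n]) (enc_list enc_nat (Opt v)))"

definition encp :: "nat \<times> nat \<Rightarrow> data" where
  "encp p = Node (encv (fst p)) (enc_nat (snd p))"

abbreviation "encvs \<equiv> enc_list encv"
abbreviation "encs \<equiv> enc_list encp"
abbreviation "encss \<equiv> enc_list encs"

lemma encv_simps [simp]:
  "left_subtree (encv v) = enc_nat v"
  "left_subtree (right_subtree (encv v)) = enc_list (\<lambda>u. enc_bool (E v u)) [0..<n]"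
  "right_subtree (right_subtree (encv v)) = enc_list enc_nat (Opt v)"
  "encv v \<noteq> Leaf"
  by (simp_all add: encv_def)

lemma encp_simps [simp]:
  "left_subtree (encp p) = encv (fst p)"
  "right_subtree (encp p) = enc_nat (snd p)"
  "encp p \<noteq> Leaf"
  by (simp_all add: encp_def)

lemma encp_pair [simp]: "encp (v, c) = Node (encv v) (enc_nat c)"
  by (simp add: encp_def)

lemma Opt_ne [simp]: "Opt v \<noteq> []"
  using zero_Opt[of v] by auto

lemma left_Opt [simp]: "left_subtree (enc_list f (Opt v)) = f (hd (Opt v))"
  by (cases "Opt v") (auto simp: Opt_ne)

lemma length_Opt: "length (Opt v) \<le> q + 1"
proof -
  have "card (set (Opt v)) \<le> card {..q}"
    by (rule card_mono) (auto dest: Opt_le)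
  then show ?thesis by (simp add: distinct_card[OF Opt_distinct])
qed

abbreviation "TC \<equiv> conf_time q n"
abbreviation "TL \<equiv> extl_time q n"
abbreviation "XT \<equiv> ext_time q n"
abbreviation "TA \<equiv> amin_time"
abbreviation "BT \<equiv> best_time q n"
abbreviation "DT \<equiv> dom_time q n"
abbreviation "PT \<equiv> part_time n"
abbreviation "FT \<equiv> find_time q n"
abbreviation "WT \<equiv> node_time q n"

lemma fn_nth:
  "fn (Suc 0) [enc_list f xs, enc_nat i] (if i < length xs then f (xs ! i) else Leaf)
     (20 * length xs + 20)"
proof (induction xs arbitrary: i)
  case (Cons x xs)
  show ?case
    by (cases i) (auto simp: body intro!: fn_call[OF Cons.IH])
qed (simp add: body)

lemma fn_adj:
  "fn (Suc 0) [enc_list (\<lambda>u. enc_bool (E v u)) [0..<n], enc_nat u] (enc_bool (E v u))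
     (20 * n + 20)"
proof -
  have "(if u < length [0..<n] then enc_bool (E v ([0..<n] ! u)) else Leaf) = enc_bool (E v u)"
    using E_less[of v u] by (cases "E v u") auto
  with fn_nth[of "\<lambda>u. enc_bool (E v u)" "[0..<n]" u] show ?thesis by simp
qed

lemma fn_eq: "fn 2 [enc_nat a, enc_nat b] (enc_bool (a = b)) (20 * a + 20)"
proof (induction a arbitrary: b)
  case 0
  show ?case by (cases b) (simp_all add: body)
next
  case (Suc a)
  show ?case by (cases b) (auto simp: body intro!: fn_call[OF Suc.IH])
qed

lemma fn_le: "fn 3 [enc_nat a, enc_nat b] (enc_bool (a \<le> b)) (20 * a + 20)"
proof (induction a arbitrary: b)
  case 0
  show ?case by (cases b) (simp_all add: body)
next
  case (Suc a)
  show ?case by (cases b) (auto simp: body intro!: fn_call[OF Suc.IH])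
qed

lemma conf_simps [simp]:
  "\<not> conf [] v c"
  "\<not> conf r v 0"
  "c \<noteq> 0 \<Longrightarrow> conf (p # r) v c \<longleftrightarrow> (E v (fst p) \<and> c = snd p) \<or> conf r v c"
  by (cases p, auto simp: conf_def)+

lemma fn_conf:
  "fn 4 [encs r, encv v, enc_nat c] (enc_bool (conf r v c))
     ((length r + 1) * (20 * n + 20 * c + 100))"
proof (induction r)
  case (Cons p r)
  show ?case
    by (cases "c = 0")
       (auto simp: body algebra_simps intro!: fn_call[OF fn_adj] fn_call[OF fn_eq] fn_call[OF Cons.IH])
qed (simp add: body)

text \<open>The 50 steps included in \<open>conf_time\<close> are kept back to pay for the loop of
  the caller.\<close>

lemma fn_conf':
  assumes "length r \<le> m" "c \<le> q"
  shows "fn 4 [encs r, encv v, enc_nat c] (enc_bool (conf r v c)) (TC m - 50)"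
proof -
  have "(length r + 1) * (20 * n + 20 * c + 100) \<le> (m + 1) * (20 * n + 20 * q + 100)"
    using assms by (intro mult_mono) auto
  then show ?thesis unfolding conf_time_def diff_add_inverse2 by (rule fn_mono[OF fn_conf])
qed

lemma TC_ge: "TC m \<ge> 150"
  unfolding conf_time_def by simp

lemma fn_ext1:
  assumes "length r \<le> m" "\<forall>c \<in> set cs. c \<le> q"
  shows "fn 5 [enc_list enc_nat cs, encv v, encs r, encss rest]
    (encss (map (\<lambda>c. (v, c) # r) (filter (\<lambda>c. \<not> conf r v c) cs) @ rest))
    ((length cs + 1) * TC m)"
  using assms(2)
proof (induction cs)
  case Nil
  show ?case using TC_ge[of m] by (simp add: body)
next
  case (Cons c cs)
  then have *: "fn 4 [encs r, encv v, enc_nat c] (enc_bool (conf r v c)) (TC m - 50)"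
    and IH: "fn 5 [enc_list enc_nat cs, encv v, encs r, encss rest]
    (encss (map (\<lambda>c. (v, c) # r) (filter (\<lambda>c. \<not> conf r v c) cs) @ rest))
    ((length cs + 1) * TC m)"
    using fn_conf'[OF assms(1)] by auto
  show ?case using TC_ge[of m]
    by (auto simp: body algebra_simps intro!: fn_call[OF IH] fn_call[OF *])
qed

lemma fn_extl:
  assumes "\<forall>r \<in> set rs. length r \<le> m"
  shows "fn 6 [encss rs, encv v]
    (encss (concat (map (\<lambda>r. map (\<lambda>c. (v, c) # r) (filter (\<lambda>c. \<not> conf r v c) (Opt v))) rs)))
    ((length rs + 1) * TL m)"
  using assms
proof (induction rs)
  case Nil
  show ?case by (simp add: body extl_time_def)
next
  case (Cons r rs)
  have *: "fn 5 [enc_list enc_nat (Opt v), encv v, encs r, encss rest]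
    (encss (map (\<lambda>c. (v, c) # r) (filter (\<lambda>c. \<not> conf r v c) (Opt v)) @ rest))
    ((q + 2) * TC m)" for rest
  proof (rule fn_mono[OF fn_ext1])
    show "(length (Opt v) + 1) * TC m \<le> (q + 2) * TC m"
      using length_Opt[of v] by (intro mult_right_mono) auto
  qed (use Cons.prems in \<open>auto dest: Opt_le\<close>)
  have IH: "fn 6 [encss rs, encv v]
    (encss (concat (map (\<lambda>r. map (\<lambda>c. (v, c) # r) (filter (\<lambda>c. \<not> conf r v c) (Opt v))) rs)))
    ((length rs + 1) * TL m)" using Cons by simp
  show ?case
    by (auto simp: body extl_time_def algebra_simps intro!: fn_call[OF IH] fn_call[OF *])
qed

lemma length_ext: "length (ext s W) \<le> (q + 1) ^ length W"
proof (induction W)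
  case (Cons v W)
  have "length (ext s (v # W)) \<le> sum_list (map (\<lambda>_. q + 1) (ext s W))"
    unfolding ext.simps length_concat map_map comp_def length_map
    by (intro sum_list_mono) (use length_Opt length_filter_le le_trans in blast)
  also have "\<dots> = length (ext s W) * (q + 1)"
    by (simp add: sum_list_triv)
  also have "\<dots> \<le> (q + 1) ^ length W * (q + 1)"
    using Cons by (rule mult_right_mono) simp
  finally show ?case by (simp add: mult.commute)
qed simp

lemma length_ext_mem: "r \<in> set (ext s W) \<Longrightarrow> length r = length s + length W"
  by (induction W arbitrary: r) auto

lemma ext_ne: "ext s W \<noteq> []"
proof (induction W)
  case (Cons v W)
  obtain r where r: "r \<in> set (ext s W)" using Cons by (cases "ext s W") auto
  have "0 \<in> set (filter (\<lambda>c. \<not> conf r v c) (Opt v))" using zero_Opt by auto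
  then have "(v, 0) # r \<in> set (ext s (v # W))" using r by force
  then show ?case by (metis empty_iff empty_set)
qed simp

lemma XT_mono: "k \<le> k' \<Longrightarrow> XT k m \<le> XT k' m"
  unfolding ext_time_def by (intro mult_mono add_mono power_increasing) auto

lemma fn_ext:
  assumes "length s + length W \<le> m"
  shows "fn 7 [encs s, encvs W] (encss (ext s W)) (XT (length W) m)"
  using assms
proof (induction W)
  case Nil
  show ?case by (simp add: body ext_time_def)
next
  case (Cons v W)
  then have IH: "fn 7 [encs s, encvs W] (encss (ext s W)) (XT (length W) m)" by simp
  define Y where "Y = ((q + 1) ^ length W + 1) * TL m"
  have *: "fn 6 [encss (ext s W), encv v] (encss (ext s (v # W))) Y"
    unfolding ext.simps Y_def
    by (rule fn_mono[OF fn_extl[of _ m]])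
       (use Cons.prems length_ext[of s W] in \<open>auto dest: length_ext_mem intro!: mult_right_mono add_mono\<close>)
  have "XT (length W) m + Y + 50 = (length (v # W) + 1) * (((q + 1) ^ length W + 1) * TL m + 50)"
    by (simp add: ext_time_def Y_def algebra_simps)
  also have "\<dots> \<le> XT (length (v # W)) m"
    unfolding ext_time_def by (intro mult_mono add_mono power_increasing) auto
  finally show ?case
    by (auto simp: body simp del: ext.simps intro!: fn_call[OF IH] fn_call[OF *])
qed

lemma fn_zeros: "fn 8 [encs s] (enc_nat (zeros s)) (20 * length s + 20)"
proof (induction s)
  case (Cons p s)
  show ?case by (auto simp: body intro!: fn_call[OF Cons.IH])
qed (simp add: body)

lemma zeros_le: "zeros s \<le> length s"
  by (induction s) auto

lemma amin_mem: "rs \<noteq> [] \<Longrightarrow> amin rs \<in> set rs"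
  by (induction rs rule: amin.induct) auto

lemma amin_le: "r \<in> set rs \<Longrightarrow> zeros (amin rs) \<le> zeros r"
proof (induction rs rule: amin.induct)
  case (3 r' v rs)
  then show ?case
    by (cases "r = r'"; cases "zeros r' \<le> zeros (amin (v # rs))") simp_all
qed simp_all

lemma fn_amin:
  assumes "rs \<noteq> []" "\<forall>r \<in> set rs. length r \<le> m"
  shows "fn 9 [encss rs] (encs (amin rs)) (length rs * TA m)"
  using assms
proof (induction rs rule: amin.induct)
  case (3 r r' rs)
  define rs' where "rs' = r' # rs"
  have ne: "rs' \<noteq> []" by (simp add: rs'_def)
  have le: "length r \<le> m" "length (amin rs') \<le> m" "zeros r \<le> m"
    using 3(4) amin_mem[OF ne] zeros_le[of r] by (auto simp: rs'_def)
  have IH: "fn 9 [encss rs'] (encs (amin rs')) (length rs' * TA m)"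
    using 3 unfolding rs'_def by simp
  have am: "amin (r # rs') = (if zeros r \<le> zeros (amin rs') then r else amin rs')"
    by (simp add: rs'_def)
  show ?case unfolding rs'_def[symmetric] am using le ne
    by (auto simp: body amin_time_def algebra_simps
        intro!: fn_call[OF IH] fn_call[OF fn_zeros] fn_call[OF fn_le])
qed (auto simp: body amin_time_def)

lemma length_best: "length (best s W) = length s + length W"
  unfolding best_def using amin_mem[OF ext_ne, of s W] length_ext_mem by blast

lemma fn_amin_ext:
  assumes "length s + length W \<le> m"
  shows "fn 9 [encss (ext s W)] (encs (best s W)) ((q + 1) ^ length W * TA m)"
  unfolding best_def
  by (rule fn_mono[OF fn_amin[OF ext_ne]])
     (use assms length_ext in \<open>auto dest: length_ext_mem intro!: mult_right_mono\<close>)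

lemma BT_mono: "k \<le> k' \<Longrightarrow> BT k m \<le> BT k' m"
  unfolding best_time_def by (intro add_mono mult_right_mono power_increasing XT_mono) auto

lemma fn_dom:
  assumes "length r + length C \<le> m" "length C \<le> k" "r \<noteq> []"
  shows "fn 10 [encs r, encvs C] (enc_bool (dominated C r)) (DT k m)"
proof -
  obtain v c b where r: "r = (v, c) # b" using assms(3) by (metis list.exhaust surj_pair)
  let ?r0 = "(v, 0) # b"
  \<comment> \<open>\<open>Leaf\<close> is the unary 0, so the tree built by the program is the
    assignment with \<open>v\<close> deleted.\<close>
  have e0: "Node (Node (encv v) Leaf) (encs b) = encs ?r0" by (simp add: encp_def)
  have len: "length ?r0 + length C \<le> m" using assms(1) r by simp
  have z: "zeros (best ?r0 C) \<le> m" "length (best ?r0 C) \<le> m" "length (best r C) \<le> m"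
    using zeros_le[of "best ?r0 C"] assms(1) r by (auto simp: length_best)
  have dom: "dominated C r \<longleftrightarrow> c \<noteq> 0 \<and> zeros (best ?r0 C) \<le> zeros (best r C)"
    by (simp add: dominated_def r)
  have enc: "left_subtree (encs r) = encp (v, c)" "right_subtree (encs r) = encs b"
    by (simp_all add: r)
  have B: "XT (length C) m + (q + 1) ^ length C * TA m \<le> BT k m"
    using BT_mono[OF assms(2), of m] by (simp add: best_time_def)
  show ?thesis unfolding dom dom_time_def using z B
    by (auto simp: body enc e0 simp del: enc_list_simps
        intro!: fn_call[OF fn_ext[OF len]] fn_call[OF fn_ext[OF assms(1)]]
          fn_call[OF fn_amin_ext[OF len]] fn_call[OF fn_amin_ext[OF assms(1)]]
          fn_call[OF fn_zeros] fn_call[OF fn_le])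
qed

lemma fn_fdom:
  assumes "\<forall>r \<in> set rs. r \<noteq> [] \<and> length r + length C \<le> m" "length C \<le> k"
  shows "fn 11 [encss rs, encvs C] (encss (filter (\<lambda>r. \<not> dominated C r) rs))
    ((length rs + 1) * (DT k m + 50))"
  using assms(1)
proof (induction rs)
  case (Cons r rs)
  then have IH: "fn 11 [encss rs, encvs C] (encss (filter (\<lambda>r. \<not> dominated C r) rs))
    ((length rs + 1) * (DT k m + 50))"
    and *: "fn 10 [encs r, encvs C] (enc_bool (dominated C r)) (DT k m)"
    using fn_dom[OF _ assms(2)] by auto
  show ?case by (auto simp: body algebra_simps intro!: fn_call[OF IH] fn_call[OF *])
qed (simp add: body)

lemma fn_useful:
  assumes "\<forall>b \<in> set bs. length b + length C + 1 \<le> m" "length C \<le> k"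
  shows "fn 12 [encss bs, encv v, encvs C] (enc_bool (useful v C bs))
    ((length bs + 1) * (TC m + DT k m + 100))"
  using assms(1)
proof (induction bs)
  case (Cons b bs)
  let ?a = "hd (Opt v)"
  have IH: "fn 12 [encss bs, encv v, encvs C] (enc_bool (useful v C bs))
    ((length bs + 1) * (TC m + DT k m + 100))" using Cons by simp
  have 1: "fn 4 [encs b, encv v, enc_nat ?a] (enc_bool (conf b v ?a)) (TC m - 50)"
    by (rule fn_conf') (use Cons.prems in \<open>auto intro!: Opt_le[OF hd_in_set]\<close>)
  have 2: "fn 10 [Node (Node (encv v) (enc_nat ?a)) (encs b), encvs C]
    (enc_bool (dominated C ((v, ?a) # b))) (DT k m)"
    using fn_dom[of "(v, ?a) # b" C m k] Cons.prems assms(2) by (simp add: encp_def)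
  have u: "useful v C (b # bs) \<longleftrightarrow> conf b v ?a \<or> dominated C ((v, ?a) # b) \<or> useful v C bs"
    by (auto simp: useful_def)
  show ?case unfolding u
    by (auto simp: body algebra_simps intro!: fn_call[OF IH] fn_call[OF 1] fn_call[OF 2])
qed (simp add: body useful_def)

lemma fn_touches:
  "fn 13 [encv y, encvs C] (enc_bool (touches C y)) ((length C + 1) * (20 * n + 50))"
proof (induction C)
  case (Cons x C)
  have t: "touches (x # C) y \<longleftrightarrow> E y x \<or> touches C y" by (simp add: touches_def)
  show ?case unfolding t
    by (auto simp: body algebra_simps intro!: fn_call[OF fn_adj] fn_call[OF Cons.IH])
qed (simp add: body touches_def)

lemma fn_part:
  assumes "length C \<le> k"
  shows "fn 14 [encvs H, encvs C]
    (Node (encvs (filter (touches C) H)) (encvs (filter (\<lambda>y. \<not> touches C y) H)))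
    (PT k (length H))"
proof (induction H)
  case (Cons y H)
  have *: "fn 13 [encv y, encvs C] (enc_bool (touches C y)) ((k + 1) * (20 * n + 50))"
    by (rule fn_mono[OF fn_touches]) (use assms in simp)
  have e: "PT k (length (y # H)) = PT k (length H) + ((k + 1) * (20 * n + 50)) + 50"
    by (simp add: part_time_def)
  show ?case unfolding e
    by (auto simp: body simp del: mult_Suc intro!: fn_call[OF Cons.IH] fn_call[OF *])
qed (simp add: body part_time_def)

lemma fn_append:
  "fn 15 [enc_list f xs, enc_list f ys] (enc_list f (xs @ ys)) (20 * length xs + 20)"
proof (induction xs)
  case (Cons x xs)
  show ?case by (auto simp: body intro!: fn_call[OF Cons.IH])
qed (simp add: body)

lemma fn_find:
  assumes "\<forall>C \<in> set Cs. length C \<le> k \<and> length (filter (touches C) H) \<le> d"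
    and "length s + d + k + 1 \<le> m"
  shows "fn 16 [enc_list encvs Cs, encs s, encv v, encvs H] (enc_list encvs (pieces Cs s v H))
    ((length Cs + 1) * FT d k (length H) m)"
  using assms(1)
proof (induction Cs)
  case Nil
  show ?case by (simp add: body find_time_def pieces_def)
next
  case (Cons C Cs)
  let ?S = "filter (touches C) H"
  have S: "length ?S \<le> d" "length C \<le> k" using Cons.prems by auto
  have IH: "fn 16 [enc_list encvs Cs, encs s, encv v, encvs H] (enc_list encvs (pieces Cs s v H))
    ((length Cs + 1) * FT d k (length H) m)" using Cons by simp
  have 1: "fn 7 [encs s, encvs ?S] (encss (ext s ?S)) (XT d m)"
    by (rule fn_mono[OF fn_ext[of _ _ m] XT_mono]) (use S assms(2) in auto)
  have 2: "fn 12 [encss (ext s ?S), encv v, encvs C] (enc_bool (useful v C (ext s ?S)))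
    (((q + 1) ^ d + 1) * (TC m + DT k m + 100))"
  proof (rule fn_mono[OF fn_useful])
    have "(q + 1) ^ length ?S \<le> (q + 1) ^ d" using S by (intro power_increasing) auto
    with length_ext[of s ?S] show "(length (ext s ?S) + 1) * (TC m + DT k m + 100)
      \<le> ((q + 1) ^ d + 1) * (TC m + DT k m + 100)"
      by (intro mult_right_mono add_mono) auto
  qed (use S assms(2) in \<open>auto dest: length_ext_mem\<close>)
  have p: "pieces (C # Cs) s v H = (if useful v C (ext s ?S) then C # Cs else pieces Cs s v H)"
    by (simp add: pieces_def)
  have e: "(length (C # Cs) + 1) * FT d k (length H) m
    = (length Cs + 1) * FT d k (length H) m + PT k (length H) + XT d m
      + ((q + 1) ^ d + 1) * (TC m + DT k m + 100) + 100"
    by (simp add: find_time_def algebra_simps)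
  show ?case unfolding p e
    by (auto simp: body simp del: mult_Suc
      intro!: fn_call[OF IH] fn_call[OF fn_part[OF S(2)]] fn_call[OF 1] fn_call[OF 2])
qed

lemma fn_finish:
  assumes "\<forall>C \<in> set Cs. length C \<le> k" "length s + length (concat Cs) \<le> m"
  shows "fn 19 [enc_list encvs Cs, encs s] (encs (finish Cs s)) ((length Cs + 1) * (BT k m + 50))"
  using assms
proof (induction Cs arbitrary: s)
  case (Cons C Cs)
  have len: "length s + length C \<le> m" "length C \<le> k" using Cons.prems by auto
  have IH: "fn 19 [enc_list encvs Cs, encs (best s C)] (encs (finish Cs (best s C)))
    ((length Cs + 1) * (BT k m + 50))"
    by (rule Cons.IH) (use Cons.prems in \<open>auto simp: length_best\<close>)
  have B: "XT (length C) m + (q + 1) ^ length C * TA m \<le> BT k m"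
    using BT_mono[OF len(2), of m] by (simp add: best_time_def)
  have e: "(length (C # Cs) + 1) * (BT k m + 50) = (length Cs + 1) * (BT k m + 50) + BT k m + 50"
    by simp
  show ?case unfolding e using B
    by (auto simp: body simp del: mult_Suc
      intro!: fn_call[OF IH] fn_call[OF fn_ext[OF len(1)]] fn_call[OF fn_amin_ext[OF len(1)]])
qed (simp add: body)

end

section \<open>Strict branch counts and the size of the search tree\<close>

text \<open>One short block makes the whole concatenation short; this single unit is what brings a
  branching on \<open>k\<close> vertices below \<open>(q + 1) ^ k\<close>.\<close>

lemma length_concat_map_less:
  assumes "\<forall>r \<in> set rs. length (f r) \<le> N" "\<exists>r \<in> set rs. length (f r) < N"
  shows "length (concat (map f rs)) < length rs * N"
  using assms
proof (induction rs)
  case (Cons r rs)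
  have le: "length (concat (map f rs)) \<le> length rs * N"
    using Cons.prems(1) sum_list_mono[of rs "\<lambda>r. length (f r)" "\<lambda>_. N"]
    by (simp add: length_concat comp_def sum_list_triv)
  show ?case
  proof (cases "length (f r) < N")
    case True
    with le show ?thesis by simp
  next
    case False
    with Cons have "length (concat (map f rs)) < length rs * N" by auto
    with Cons.prems(1) show ?thesis by simp
  qed
qed simp

context instance_data
begin

lemma length_less_if_missing:
  assumes "distinct cs" "set cs \<subseteq> {..q}" "a \<le> q" "a \<notin> set cs"
  shows "length cs \<le> q"
proof -
  have "card (set cs) \<le> card ({..q} - {a})"
    using assms by (intro card_mono) auto
  then show ?thesis using assms by (simp add: distinct_card)
qed

text \<open>Colour 1 alone gives the saving: if \<open>u\<close> cannot take it, \<open>u\<close>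
  has at most \<open>q\<close> options; if \<open>u\<close> takes it, \<open>v\<close> has at most
  \<open>q\<close> options in that block.\<close>

lemma length_ext_edge:
  assumes "E v u" "1 \<le> q"
  shows "length (ext s [v, u]) < (q + 1) ^ 2"
proof -
  let ?f = "\<lambda>r v. filter (\<lambda>c. \<not> conf r v c) (Opt v)"
  have f: "distinct (?f r w)" "set (?f r w) \<subseteq> {..q}" for r w
    using Opt_distinct by (auto dest: Opt_le)
  have le: "length (?f r w) \<le> q + 1" for r w
    by (rule le_trans[OF length_filter_le length_Opt])
  have e: "ext s [v, u] = concat (map (\<lambda>r. map (\<lambda>c. (v, c) # r) (?f r v)) (ext s [u]))"
    by simp
  have len: "length (ext s [u]) = length (?f s u)" by simp
  show ?thesis
  proof (cases "1 \<in> set (?f s u)")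
    case True
    then have mem: "(u, 1) # s \<in> set (ext s [u])" by simp
    have "conf ((u, 1) # s) v 1" using assms(1) by simp
    then have "length (?f ((u, 1) # s) v) \<le> q"
      by (intro length_less_if_missing[OF f assms(2)]) simp
    then have ex: "\<exists>r \<in> set (ext s [u]). length (map (\<lambda>c. (v, c) # r) (?f r v)) < q + 1"
      by (intro bexI[OF _ mem]) simp
    have "length (ext s [v, u]) < length (ext s [u]) * (q + 1)"
      unfolding e by (rule length_concat_map_less[OF _ ex]) (simp only: length_map le ball_triv simp_thms)
    also have "\<dots> \<le> (q + 1) * (q + 1)"
      using le[of s u] unfolding len by (intro mult_right_mono) auto
    finally show ?thesis by (simp add: power2_eq_square)
  next
    case False
    then have "length (ext s [u]) \<le> q"
      unfolding len by (intro length_less_if_missing[OF f assms(2)])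
    moreover have "length (ext s [v, u]) \<le> length (ext s [u]) * (q + 1)"
      unfolding e using sum_list_mono[of "ext s [u]" "\<lambda>r. length (?f r v)" "\<lambda>_. q + 1", OF le]
      by (simp only: length_concat map_map comp_def length_map sum_list_triv of_nat_id)
    ultimately have "length (ext s [v, u]) \<le> q * (q + 1)"
      by (rule le_trans[OF _ mult_le_mono1, rotated])
    then show ?thesis by (simp add: power2_eq_square)
  qed
qed

text \<open>In the block of the witness \<open>b\<close> the first option of \<open>v\<close> is
  missing: either a conflict keeps it out of \<open>ext\<close> or the domination filter drops
  it.\<close>

lemma length_ext_useful:
  assumes "useful v C (ext s S)"
  shows "length (filter (\<lambda>r. \<not> dominated C r) (ext s (v # S))) < (q + 1) ^ (length S + 1)"
proof -
  let ?P = "\<lambda>r. \<not> dominated C r"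
  let ?f = "\<lambda>r. filter ?P (map (\<lambda>c. (v, c) # r) (filter (\<lambda>c. \<not> conf r v c) (Opt v)))"
  have e: "filter ?P (ext s (v # S)) = concat (map ?f (ext s S))"
    by (simp add: filter_concat comp_def)
  have len: "length (?f r) = length (filter (\<lambda>c. \<not> conf r v c \<and> ?P ((v, c) # r)) (Opt v))" for r
    by (simp add: filter_map comp_def conj_commute)
  obtain b where b: "b \<in> set (ext s S)" "conf b v (hd (Opt v)) \<or> dominated C ((v, hd (Opt v)) # b)"
    using assms unfolding useful_def by blast
  have "length (?f b) < q + 1"
    unfolding len
    by (rule less_le_trans[OF length_filter_less[OF hd_in_set[OF Opt_ne]] length_Opt])
       (use b(2) in blast)
  moreover have "length (?f r) \<le> q + 1" for r
    unfolding len by (rule le_trans[OF length_filter_le length_Opt])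
  ultimately have "length (filter ?P (ext s (v # S))) < length (ext s S) * (q + 1)"
    unfolding e using b(1) by (intro length_concat_map_less) blast+
  also have "\<dots> \<le> (q + 1) ^ length S * (q + 1)"
    using length_ext by (intro mult_right_mono) auto
  finally show ?thesis by (simp add: mult.commute)
qed

text \<open>Deleting \<open>v\<close> neither conflicts nor is dominated, so that branch survives
  and \<open>amin\<close> has something to choose from.\<close>

lemma undominated_ne: "filter (\<lambda>r. \<not> dominated C r) (ext s (v # S)) \<noteq> []"
proof -
  obtain r where r: "r \<in> set (ext s S)" using ext_ne[of s S] by (cases "ext s S") auto
  have "(v, 0) # r \<in> set (ext s (v # S))" using r zero_Opt[of v] by force
  moreover have "\<not> dominated C ((v, 0) # r)" by (simp add: dominated_def)
  ultimately show ?thesis unfolding filter_empty_conv by blast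
qed

lemma length_finish: "length (finish Cs s) = length s + length (concat Cs)"
  by (induction Cs arbitrary: s) (auto simp: length_best)

text \<open>Lets the program find the neighbours of one vertex with the same partition function that
  it uses for components.\<close>

lemma filter_touches_single: "filter (touches [v]) H = filter (E v) H"
  "filter (\<lambda>y. \<not> touches [v] y) H = filter (\<lambda>y. \<not> E v y) H"
  by (auto simp: touches_def intro!: filter_cong dest: E_sym)

text \<open>For the running time: \<open>amin\<close> compares unary counts, at a cost that grows
  with the lengths of the assignments returned by the children.\<close>

lemma length_solve: "length (solve Cs s H) = length s + length H + length (concat Cs)"
proof (induction "length H" arbitrary: s H rule: less_induct)
  case less
  show ?case
  proof (cases H)
    case Nil
    then show ?thesis by (simp add: length_finish)
  next
    case (Cons v H')
    consider u S where "filter (E v) H' = u # S"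
      | C D where "filter (E v) H' = []" "pieces Cs s v H' = C # D"
      | "filter (E v) H' = []" "pieces Cs s v H' = []"
      by (meson list.exhaust)
    then show ?thesis
    proof cases
      case 1
      let ?R = "S @ filter (\<lambda>y. \<not> E v y) H'"
      have l: "length ?R + 2 = length H"
        using sum_length_filter_compl[of "E v" H'] 1 Cons by simp
      have "amin (map (\<lambda>b. solve Cs b ?R) (ext s [v, u])) \<in>
        set (map (\<lambda>b. solve Cs b ?R) (ext s [v, u]))"
        using ext_ne by (intro amin_mem) blast
      then obtain b where b: "b \<in> set (ext s [v, u])" "solve Cs s H = solve Cs b ?R"
        using 1 Cons by auto
      show ?thesis using less[of ?R b] l length_ext_mem[OF b(1)] b(2) by simp
    next
      case 2
      let ?R = "filter (\<lambda>y. \<not> touches C y) H'"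
      let ?B = "filter (\<lambda>r. \<not> dominated C r) (ext s (v # filter (touches C) H'))"
      have l: "length ?R + length (filter (touches C) H') + 1 = length H"
        using sum_length_filter_compl[of "touches C" H'] Cons by simp
      have "amin (map (\<lambda>b. solve Cs b ?R) ?B) \<in> set (map (\<lambda>b. solve Cs b ?R) ?B)"
        using undominated_ne by (intro amin_mem) blast
      then obtain b where b: "b \<in> set (ext s (v # filter (touches C) H'))"
          "solve Cs s H = solve Cs b ?R"
        using 2 Cons by auto
      show ?thesis using less[of ?R b] l length_ext_mem[OF b(1)] b(2) by simp
    next
      case 3
      then show ?thesis using less[of H'] Cons by simp
    qed
  qed
qed

lemma PT_mono: "k \<le> k' \<Longrightarrow> h \<le> h' \<Longrightarrow> PT k h \<le> PT k' h'"
  unfolding part_time_def by (intro mult_mono add_mono) auto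

lemma FT_mono: "h \<le> h' \<Longrightarrow> FT d k h m \<le> FT d k h' m"
  unfolding find_time_def by (intro add_mono PT_mono) auto

lemma fn_solvel:
  assumes "\<And>b. b \<in> set bs \<Longrightarrow> fn 17 [Ce, encs b, R] (encs (g b)) B"
  shows "fn 18 [Ce, encss bs, R] (encss (map g bs)) (length bs * (B + 50) + 20)"
  using assms
proof (induction bs)
  case (Cons b bs)
  then have IH: "fn 18 [Ce, encss bs, R] (encss (map g bs)) (length bs * (B + 50) + 20)"
    and 1: "fn 17 [Ce, encs b, R] (encs (g b)) B" by auto
  show ?case by (auto simp: body intro!: fn_call[OF IH] fn_call[OF 1])
qed (simp add: body)

text \<open>The recursive part keeps the exact number of branches, the one known to be strictly
  below \<open>(q + 1) ^ j\<close>; the overhead per branch may use the cruder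
  \<open>N\<close>.\<close>

lemma fn_branch:
  assumes bs: "bs \<noteq> []" "length bs \<le> N" "\<And>b. b \<in> set bs \<Longrightarrow> length (solve Cs b R) \<le> m"
    and fn: "\<And>b. b \<in> set bs \<Longrightarrow>
      fn 17 [enc_list encvs Cs, encs b, encvs R] (encs (solve Cs b R)) B"
  shows "fn 18 [enc_list encvs Cs, encss bs, encvs R] (encss (map (\<lambda>b. solve Cs b R) bs))
      (length bs * B + N * 50 + 20)" (is ?A)
    and "fn 9 [encss (map (\<lambda>b. solve Cs b R) bs)]
      (encs (amin (map (\<lambda>b. solve Cs b R) bs))) (N * TA m)" (is ?B)
proof -
  show ?A by (rule fn_mono[OF fn_solvel[OF fn]]) (use bs in \<open>auto simp: algebra_simps\<close>)
  show ?B by (rule fn_mono[OF fn_amin[of _ m]]) (use bs in auto)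
qed

text \<open>A node that decides \<open>j\<close> hub vertices has at most \<open>x ^ j\<close>
  children, and the factor \<open>length H + 1\<close> accounts for the levels of the search tree.
  The two conditions on \<open>m\<close> cover complete assignments and partial ones extended by a
  branching and one component.\<close>

lemma fn_solve:
  fixes x :: real
  assumes q: "1 \<le> q"
    and x: "1 \<le> x" "\<And>j. 1 \<le> j \<Longrightarrow> j \<le> max 2 (d + 1) \<Longrightarrow> (real q + 1) ^ j - 1 \<le> x ^ j"
    and Cs: "\<forall>C \<in> set Cs. length C \<le> k \<and> card {y \<in> Q. touches C y} \<le> d"
    and Q: "finite Q"
    and m: "p + length (concat Cs) \<le> m" "p + d + k + 2 \<le> m"
  shows "\<lbrakk>distinct H; set H \<subseteq> Q; length s + length H \<le> p\<rbrakk> \<Longrightarrow>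
    \<exists>B. fn 17 [enc_list encvs Cs, encs s, encvs H] (encs (solve Cs s H)) B \<and>
      real B \<le> (real (length H) + 1) * real (WT d k p m (length Cs)) * x ^ length H"
proof (induction "length H" arbitrary: s H rule: less_induct)
  case less
  define W where "W = WT d k p m (length Cs)"
  define T where "T h = (real h + 1) * real W * x ^ h" for h :: nat
  have T0: "0 \<le> T h" for h unfolding T_def using x(1) by simp
  define D where "D = max 2 (d + 1)"
  define N where "N = (q + 1) ^ D"
  have rec: "real (W + b * nat \<lfloor>T h'\<rfloor>) \<le> T h"
    if "h = h' + j" "1 \<le> j" "j \<le> D" "b < (q + 1) ^ j" for h h' j b
  proof -
    \<comment> \<open>Strictness enters here: an integer below \<open>(q + 1) ^ j\<close> is at most
      \<open>(q + 1) ^ j - 1\<close>, which \<open>x ^ j\<close> dominates.\<close>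
    have "real b + 1 \<le> real ((q + 1) ^ j)" using that(4) by linarith
    then have "real b \<le> (real q + 1) ^ j - 1" by (simp add: add.commute)
    also have "\<dots> \<le> x ^ j" using x(2) that D_def by simp
    finally have b: "real b \<le> x ^ j" .
    have "real (nat \<lfloor>T h'\<rfloor>) \<le> T h'" using T0[of h'] by linarith
    then have "real b * real (nat \<lfloor>T h'\<rfloor>) \<le> x ^ j * T h'"
      using b x(1) by (intro mult_mono) auto
    also have "\<dots> = (real h' + 1) * real W * x ^ h"
      unfolding T_def that(1) by (simp add: power_add)
    finally have 1: "real b * real (nat \<lfloor>T h'\<rfloor>) \<le> (real h' + 1) * real W * x ^ h" .
    \<comment> \<open>The work of the node itself is at most \<open>W * x ^ h\<close>; it is paid by
      the linear factor, which grows by at least one because \<open>1 \<le> j\<close>.\<close>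
    have "real W * 1 \<le> real W * x ^ h" using x(1) by (intro mult_left_mono one_le_power) auto
    then have "real (W + b * nat \<lfloor>T h'\<rfloor>) \<le> (real h' + 2) * (real W * x ^ h)"
      using 1 by (simp add: algebra_simps)
    also have "\<dots> \<le> (real h + 1) * (real W * x ^ h)"
      using that(1,2) x(1) by (intro mult_right_mono) auto
    finally show ?thesis by (simp add: T_def algebra_simps)
  qed
  have child: "fn 17 [enc_list encvs Cs, encs b, encvs R] (encs (solve Cs b R)) (nat \<lfloor>T (length R)\<rfloor>)"
    if "length R < length H" "distinct R" "set R \<subseteq> Q" "length b + length R \<le> p" for b R
  proof -
    note IH = less.hyps[OF that]
    obtain B where "fn 17 [enc_list encvs Cs, encs b, encvs R] (encs (solve Cs b R)) B"
      "real B \<le> T (length R)"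
      using IH unfolding T_def W_def by blast
    then show ?thesis by (elim fn_mono) linarith
  qed
  have "\<exists>B. fn 17 [enc_list encvs Cs, encs s, encvs H] (encs (solve Cs s H)) B \<and> real B \<le> T (length H)"
  proof (cases H)
    case Nil
    have fin: "fn 19 [enc_list encvs Cs, encs s] (encs (finish Cs s)) ((length Cs + 1) * (BT k m + 50))"
      by (rule fn_finish) (use Cs m less.prems in auto)
    have "fn 17 [enc_list encvs Cs, encs s, encvs H] (encs (solve Cs s H)) W"
      unfolding W_def node_time_def Nil
      by (auto simp: body simp del: mult_Suc mult_Suc_right intro!: fn_call[OF fin])
    moreover have "real W \<le> T (length H)" unfolding T_def Nil by simp
    ultimately show ?thesis by blast
  next
    case (Cons v H')
    have H': "distinct H'" "set H' \<subseteq> Q" "length s + length H' + 1 \<le> p" "length H' \<le> p"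
      using less.prems Cons by auto
    have part: "fn 14 [encvs H', Node (encv v) Leaf]
        (Node (encvs (filter (E v) H')) (encvs (filter (\<lambda>y. \<not> E v y) H'))) (PT (k + 1) p)"
      using fn_mono[OF fn_part[of "[v]" "k + 1" H'] PT_mono[OF _ H'(4)]]
      by (simp add: filter_touches_single)
    have S: "length (filter (touches C) H') \<le> d" if "C \<in> set Cs" for C
    proof -
      have "length (filter (touches C) H') = card (set (filter (touches C) H'))"
        using distinct_card[of "filter (touches C) H'"] H'(1) by simp
      also have "\<dots> \<le> card {y \<in> Q. touches C y}"
        using H'(2) Q by (intro card_mono) auto
      finally show ?thesis using Cs that by fastforce
    qed
    have find: "fn 16 [enc_list encvs Cs, encs s, encv v, encvs H'] (enc_list encvs (pieces Cs s v H'))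
        ((length Cs + 1) * FT d k p m)"
    proof (rule fn_mono[OF fn_find])
      show "\<forall>C \<in> set Cs. length C \<le> k \<and> length (filter (touches C) H') \<le> d" using Cs S by blast
      show "length s + d + k + 1 \<le> m" using H'(3) m by linarith
    qed (intro mult_left_mono FT_mono H'(4), simp)
    consider u S where "filter (E v) H' = u # S"
      | C D where "filter (E v) H' = []" "pieces Cs s v H' = C # D"
      | "filter (E v) H' = []" "pieces Cs s v H' = []"
      by (meson list.exhaust)
    then show ?thesis
    proof cases
      case 1
      let ?R = "S @ filter (\<lambda>y. \<not> E v y) H'"
      let ?bs = "ext s [v, u]"
      let ?B = "nat \<lfloor>T (length ?R)\<rfloor>"
      have l: "length ?R + 2 = length H"
        using sum_length_filter_compl[of "E v" H'] 1 Cons by simp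
      have "distinct (filter (E v) H')" "set (filter (E v) H') \<subseteq> set H'"
        "\<forall>y \<in> set (filter (E v) H'). E v y" using H'(1) by auto
      then have R: "distinct ?R" "set ?R \<subseteq> Q" and uv: "E v u"
        using H'(1,2) unfolding 1 by auto
      have less2: "length ?bs < (q + 1) ^ 2" by (rule length_ext_edge[OF uv q])
      have "(q + 1) ^ 2 \<le> N" unfolding N_def D_def by (intro power_increasing) auto
      then have le: "length ?bs \<le> N" using less2 by linarith
      have ch: "fn 17 [enc_list encvs Cs, encs b, encvs ?R] (encs (solve Cs b ?R)) ?B"
        if "b \<in> set ?bs" for b
        by (rule child) (use l R length_ext_mem[OF that] less.prems(3) in auto)
      have len: "length (solve Cs b ?R) \<le> m" if "b \<in> set ?bs" for b
        unfolding length_solve using length_ext_mem[OF that] l less.prems(3) m(1) by simp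
      note br = fn_branch[OF ext_ne le len ch, simplified solve.simps]
      have ext: "fn 7 [encs s, Node (encv v) (Node (encv u) Leaf)] (encss ?bs) (XT D m)"
        using fn_mono[OF fn_ext[of s "[v, u]" m] XT_mono[of _ D m]] H'(3) m by (simp add: D_def)
      have app: "fn 15 [encvs S, encvs (filter (\<lambda>y. \<not> E v y) H')] (encvs ?R) (20 * p + 20)"
        by (rule fn_mono[OF fn_append]) (use l less.prems(3) in auto)
      have W: "W \<ge> PT (k + 1) p + 20 * p + XT D m + N * TA m + N * 50 + 300"
        unfolding W_def node_time_def D_def[symmetric] N_def[symmetric] by (simp add: algebra_simps)
      have sol: "solve Cs s H = amin (map (\<lambda>b. solve Cs b ?R) ?bs)"
        using 1 Cons by simp
      have "fn 17 [enc_list encvs Cs, encs s, encvs H] (encs (solve Cs s H)) (W + length ?bs * ?B)"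
        unfolding sol Cons using W
        by (auto simp: body 1 simp del: ext.simps mult_Suc mult_Suc_right
          intro!: fn_call[OF part] fn_call[OF ext] fn_call[OF app] fn_call[OF br(1)] fn_call[OF br(2)])
      moreover have "real (W + length ?bs * ?B) \<le> T (length H)"
        by (rule rec[OF l[symmetric] _ _ less2]) (auto simp: D_def)
      ultimately show ?thesis by blast
    next
      case (2 C Ds)
      let ?S = "filter (touches C) H'"
      let ?R = "filter (\<lambda>y. \<not> touches C y) H'"
      let ?bs = "filter (\<lambda>r. \<not> dominated C r) (ext s (v # ?S))"
      let ?B = "nat \<lfloor>T (length ?R)\<rfloor>"
      have C: "C \<in> set Cs" "useful v C (ext s ?S)"
        using 2(2) unfolding pieces_def by (metis dropWhile_eq_Cons_conv set_dropWhileD list.set_intros(1))+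
      then have k: "length C \<le> k" and Sd: "length ?S \<le> d" using Cs S by auto
      have l: "length H = length ?R + (length ?S + 1)"
        using sum_length_filter_compl[of "touches C" H'] Cons by simp
      have R: "distinct ?R" "set ?R \<subseteq> Q" using H'(1,2) by auto
      have less2: "length ?bs < (q + 1) ^ (length ?S + 1)" by (rule length_ext_useful[OF C(2)])
      have N: "(q + 1) ^ (length ?S + 1) \<le> N"
        unfolding N_def D_def using Sd by (intro power_increasing) auto
      have le: "length ?bs \<le> N" using less2 N by linarith
      have ch: "fn 17 [enc_list encvs Cs, encs b, encvs ?R] (encs (solve Cs b ?R)) ?B"
        if "b \<in> set ?bs" for b
        by (rule child) (use l R that less.prems(3) in \<open>auto dest!: length_ext_mem simp del: ext.simps\<close>)
      have len: "length (solve Cs b ?R) \<le> m" if "b \<in> set ?bs" for b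
        unfolding length_solve using that l less.prems(3) m(1)
        by (auto dest!: length_ext_mem simp del: ext.simps)
      note br = fn_branch[OF undominated_ne le len ch]
      have sm: "length s + length (v # ?S) + length C \<le> m" using H'(3) m Sd k by simp
      have ext: "fn 7 [encs s, Node (encv v) (encvs ?S)] (encss (ext s (v # ?S))) (XT D m)"
        using fn_mono[OF fn_ext[of s "v # ?S" m] XT_mono[of _ D m]] sm Sd by (simp add: D_def)
      have fd: "fn 11 [encss (ext s (v # ?S)), encvs C] (encss ?bs) ((N + 1) * (DT k m + 50))"
      proof (rule fn_mono[OF fn_fdom[OF _ k]])
        show "\<forall>r \<in> set (ext s (v # ?S)). r \<noteq> [] \<and> length r + length C \<le> m"
          using sm by (auto dest!: length_ext_mem simp del: ext.simps)
        show "(length (ext s (v # ?S)) + 1) * (DT k m + 50) \<le> (N + 1) * (DT k m + 50)"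
          using length_ext[of s "v # ?S"] N by (intro mult_right_mono) (auto simp del: ext.simps)
      qed
      have part2: "fn 14 [encvs H', encvs C] (Node (encvs ?S) (encvs ?R)) (PT (k + 1) p)"
        by (rule fn_mono[OF fn_part[OF k] PT_mono[OF _ H'(4)]]) simp
      have find': "fn 16 [enc_list encvs Cs, encs s, encv v, encvs H'] (Node (encvs C) (enc_list encvs Ds))
        ((length Cs + 1) * FT d k p m)" using find unfolding 2(2) by simp
      define F where "F = (length Cs + 1) * FT d k p m"
      define F2 where "F2 = (N + 1) * (DT k m + 50)"
      define F3 where "F3 = N * TA m"
      have W: "W \<ge> 2 * PT (k + 1) p + XT D m + F + F2 + F3 + N * 50 + 300"
        unfolding W_def node_time_def D_def[symmetric] N_def[symmetric] F_def F2_def F3_def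
        by (simp add: algebra_simps)
      have sol: "solve Cs s H = amin (map (\<lambda>b. solve Cs b ?R) ?bs)"
        using 2 Cons by simp
      have "fn 17 [enc_list encvs Cs, encs s, encvs H] (encs (solve Cs s H)) (W + length ?bs * ?B)"
        unfolding sol Cons using W
        by (auto simp: body 2 simp del: ext.simps mult_Suc mult_Suc_right
          intro!: fn_call[OF part] fn_call[OF find'[folded F_def]] fn_call[OF part2] fn_call[OF ext]
            fn_call[OF fd[folded F2_def]] fn_call[OF br(1)] fn_call[OF br(2)[folded F3_def]])
      moreover have "real (W + length ?bs * ?B) \<le> T (length H)"
        by (rule rec[OF l _ _ less2]) (use Sd in \<open>auto simp: D_def\<close>)
      ultimately show ?thesis by blast
    next
      case 3
      let ?B = "nat \<lfloor>T (length H')\<rfloor>"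
      let ?s = "(v, hd (Opt v)) # s"
      have ch: "fn 17 [enc_list encvs Cs, Node (Node (encv v) (enc_nat (hd (Opt v)))) (encs s), encvs H']
          (encs (solve Cs ?s H')) ?B"
        using child[of H' ?s] Cons H' by simp
      have find': "fn 16 [enc_list encvs Cs, encs s, encv v, encvs H'] Leaf
        ((length Cs + 1) * FT d k p m)" using find unfolding 3(2) by simp
      define F where "F = (length Cs + 1) * FT d k p m"
      have W: "W \<ge> 2 * PT (k + 1) p + F + 300"
        unfolding W_def node_time_def D_def[symmetric] N_def[symmetric] F_def
        by (simp add: algebra_simps)
      have sol: "solve Cs s H = solve Cs ?s H'"
        using 3 Cons by simp
      \<comment> \<open>The factor 1 matches \<open>rec\<close> for a single branch and
        \<open>j = 1\<close>, where the strict bound is \<open>1 < q + 1\<close>.\<close>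
      have "fn 17 [enc_list encvs Cs, encs s, encvs H] (encs (solve Cs s H)) (W + 1 * ?B)"
        unfolding sol Cons using W
        by (auto simp: body 3 simp del: mult_Suc mult_Suc_right
          intro!: fn_call[OF part] fn_call[OF find'[folded F_def]] fn_call[OF ch])
      moreover have "real (W + 1 * ?B) \<le> T (length H)"
        by (rule rec[of _ _ 1]) (use Cons q in \<open>auto simp: D_def\<close>)
      ultimately show ?thesis by blast
    qed
  qed
  then show ?case unfolding T_def W_def .
qed

end

section \<open>Correctness of the branching\<close>

lemma in_set_concat_map: "y \<in> set ys \<Longrightarrow> x \<in> set (F y) \<Longrightarrow> x \<in> set (concat (map F ys))"
  by auto

context instance_data
begin

text \<open>In the proofs a partial assignment is a total function together with the list of its
  vertices, so that solutions can be compared and patched pointwise.\<close>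

definition assign :: "(nat \<Rightarrow> nat) \<Rightarrow> nat list \<Rightarrow> (nat \<times> nat) list" where
  "assign f xs = map (\<lambda>v. (v, f v)) xs"

definition feas :: "(nat \<Rightarrow> nat) \<Rightarrow> nat set \<Rightarrow> bool" where
  "feas f U \<longleftrightarrow> (\<forall>v \<in> U. f v \<in> set (Opt v)) \<and>
     (\<forall>u \<in> U. \<forall>v \<in> U. E u v \<longrightarrow> f u = f v \<longrightarrow> f u = 0)"

definition cost :: "(nat \<Rightarrow> nat) \<Rightarrow> nat set \<Rightarrow> nat" where
  "cost f U = card {v \<in> U. f v = 0}"

lemma assign_simps [simp]:
  "assign f [] = []" "assign f (x # xs) = (x, f x) # assign f xs"
  by (simp_all add: assign_def)

lemma assign_cong: "(\<And>x. x \<in> set xs \<Longrightarrow> f x = g x) \<Longrightarrow> assign f xs = assign g xs"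
  by (simp add: assign_def)

lemma assign_eqD: "assign f xs = assign g xs \<Longrightarrow> x \<in> set xs \<Longrightarrow> f x = g x"
  by (simp add: assign_def)

lemma cost_cong: "(\<And>x. x \<in> A \<Longrightarrow> f x = g x) \<Longrightarrow> cost f A = cost g A"
  unfolding cost_def by (rule arg_cong[of _ _ card]) auto

lemma cost_Un:
  assumes "finite A" "finite B" "A \<inter> B = {}"
  shows "cost f (A \<union> B) = cost f A + cost f B"
proof -
  have "{v \<in> A \<union> B. f v = 0} = {v \<in> A. f v = 0} \<union> {v \<in> B. f v = 0}" by auto
  then show ?thesis unfolding cost_def using assms by (simp add: card_Un_disjoint disjoint_iff)
qed

lemma cost_insert:
  assumes "finite A" "v \<notin> A"
  shows "cost f (insert v A) = (if f v = 0 then 1 else 0) + cost f A"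
proof -
  have "{w \<in> insert v A. f w = 0} = (if f v = 0 then insert v {w \<in> A. f w = 0} else {w \<in> A. f w = 0})"
    by auto
  then show ?thesis unfolding cost_def using assms by simp
qed

lemma cost_subset_split:
  assumes "finite V" "U \<subseteq> V"
  shows "cost f V = cost f U + cost f (V - U)"
  using cost_Un[of U "V - U" f] assms finite_subset[OF assms(2,1)] by (simp add: Un_absorb1)

lemma zeros_assign: "distinct xs \<Longrightarrow> zeros (assign f xs) = cost f (set xs)"
  by (induction xs) (auto simp: cost_insert, simp_all add: cost_def)

lemma conf_assign: "conf (assign f xs) v c \<longleftrightarrow> c \<noteq> 0 \<and> (\<exists>u \<in> set xs. f u = c \<and> E v u)"
  by (auto simp: conf_def assign_def)

lemma feasI:
  assumes "\<And>v. v \<in> U \<Longrightarrow> f v \<in> set (Opt v)"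
    and "\<And>u v. u \<in> U \<Longrightarrow> v \<in> U \<Longrightarrow> E u v \<Longrightarrow> f u = f v \<Longrightarrow> f u = 0"
  shows "feas f U"
  using assms unfolding feas_def by blast

lemma feas_Opt: "feas f U \<Longrightarrow> v \<in> U \<Longrightarrow> f v \<in> set (Opt v)"
  unfolding feas_def by blast

lemma feasD: "feas f U \<Longrightarrow> u \<in> U \<Longrightarrow> v \<in> U \<Longrightarrow> E u v \<Longrightarrow> f u = f v \<Longrightarrow> f u = 0"
  unfolding feas_def by blast

lemma feas_subset: "feas f V \<Longrightarrow> U \<subseteq> V \<Longrightarrow> feas f U"
  unfolding feas_def by blast

lemma feas_cong: "(\<And>x. x \<in> U \<Longrightarrow> f x = g x) \<Longrightarrow> feas f U \<longleftrightarrow> feas g U"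
  unfolding feas_def by simp

lemma feas_insert:
  "feas f (insert v U) \<longleftrightarrow>
    feas f U \<and> f v \<in> set (Opt v) \<and> \<not> (f v \<noteq> 0 \<and> (\<exists>u \<in> U. f u = f v \<and> E v u))" (is "?L \<longleftrightarrow> ?R")
proof
  assume L: ?L
  have 1: "feas f U" by (rule feas_subset[OF L]) (rule subset_insertI)
  have 2: "f v = 0" if "u \<in> U" "f u = f v" "E v u" for u
    by (rule feasD[OF L insertI1 insertI2[OF that(1)] that(3) that(2)[symmetric]])
  have 3: "\<not> (f v \<noteq> 0 \<and> (\<exists>u \<in> U. f u = f v \<and> E v u))"
    by (rule notI, elim conjE bexE) (drule 2, simp_all)
  show ?R by (rule conjI[OF 1 conjI[OF feas_Opt[OF L insertI1] 3]])
next
  assume R: ?R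
  then have R1: "feas f U" and R2: "f v \<in> set (Opt v)" by simp_all
  have R3: "f v = 0" if "w \<in> U" "f w = f v" "E v w" for w
  proof -
    have "\<exists>u \<in> U. f u = f v \<and> E v u" using that by (intro bexI[of _ w] conjI)
    with R show ?thesis by argo
  qed
  show ?L
  proof (rule feasI)
    fix u w assume uw: "u \<in> insert v U" "w \<in> insert v U" "E u w" "f u = f w"
    show "f u = 0"
    proof (cases "u = v")
      case True
      then show ?thesis using R3[of w] uw E_irrefl[of v] by auto
    next
      case False
      show ?thesis
      proof (cases "w = v")
        case True
        then show ?thesis using R3[of u] uw(1,4) False E_sym[OF uw(3)] by auto
      next
        case w: False
        have "u \<in> U" "w \<in> U" using False w uw(1,2) by simp_all
        then show ?thesis by (rule feasD[OF R1 _ _ uw(3,4)])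
      qed
    qed
  next
    fix w assume "w \<in> insert v U"
    then show "f w \<in> set (Opt w)" using R2 feas_Opt[OF R1, of w] by auto
  qed
qed

lemma feas_delete:
  assumes "feas f U"
  shows "feas (f(v := 0)) U"
proof (rule feasI)
  fix u w assume uw: "u \<in> U" "w \<in> U" "E u w" "(f(v := 0)) u = (f(v := 0)) w"
  show "(f(v := 0)) u = 0"
  proof (cases "u = v \<or> w = v")
    case True
    then show ?thesis using uw(4) by auto
  next
    case False
    then show ?thesis using feasD[OF assms uw(1-3)] uw(4) by simp
  qed
qed (use zero_Opt feas_Opt[OF assms] in simp)

text \<open>Only edges leaving \<open>U\<close> are at risk. At their inner end \<open>g\<close>
  either deletes the vertex or agrees with \<open>h\<close>, which already respects the
  edge.\<close>

lemma feas_patch: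
  assumes "feas g U" "feas h V" "U \<subseteq> V"
    and "\<And>u w. u \<in> U \<Longrightarrow> w \<in> V - U \<Longrightarrow> E u w \<Longrightarrow> g u = h u \<or> g u = 0"
  shows "feas (\<lambda>x. if x \<in> U then g x else h x) V"
proof (rule feasI)
  let ?f = "\<lambda>x. if x \<in> U then g x else h x"
  have mixed: "g u = 0" if "u \<in> U" "w \<in> V - U" "E u w" "g u = h w" for u w
    using assms(4)[OF that(1-3)] feasD[OF assms(2) _ _ that(3)] that assms(3) by auto
  fix u w assume uw: "u \<in> V" "w \<in> V" "E u w" "?f u = ?f w"
  consider "u \<in> U" "w \<in> U" | "u \<in> U" "w \<notin> U" | "u \<notin> U" "w \<in> U" | "u \<notin> U" "w \<notin> U" by blast
  then show "?f u = 0"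
  proof cases
    case 1
    then show ?thesis using feasD[OF assms(1) 1 uw(3)] uw(4) by simp
  next
    case 2
    then show ?thesis using mixed[of u w] uw by simp
  next
    case 3
    then show ?thesis using mixed[of w u] uw E_sym[OF uw(3)] by simp
  next
    case 4
    then show ?thesis using feasD[OF assms(2) uw(1-3)] uw(4) by simp
  qed
qed (use feas_Opt[OF assms(1)] feas_Opt[OF assms(2)] in simp)

text \<open>Each step of \<open>ext\<close> drops exactly the options in conflict with the values
  chosen so far. Completeness of the enumeration is what turns a minimum over the list into a true
  optimum.\<close>

lemma ext_assign_iff:
  assumes "distinct (W @ xs)" "feas f (set xs)"
  shows "r \<in> set (ext (assign f xs) W) \<longleftrightarrow>
    (\<exists>g. r = assign g (W @ xs) \<and> feas g (set (W @ xs)) \<and> (\<forall>x \<in> set xs. g x = f x))"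
  using assms(1)
proof (induction W arbitrary: r)
  case Nil
  show ?case
  proof
    assume "r \<in> set (ext (assign f xs) [])"
    then show "\<exists>g. r = assign g ([] @ xs) \<and> feas g (set ([] @ xs)) \<and> (\<forall>x \<in> set xs. g x = f x)"
      using assms(2) by (intro exI[of _ f]) simp
  qed (auto intro: assign_cong)
next
  case (Cons v W)
  have v: "v \<notin> set (W @ xs)" and IH: "\<And>r. r \<in> set (ext (assign f xs) W) \<longleftrightarrow>
      (\<exists>g. r = assign g (W @ xs) \<and> feas g (set (W @ xs)) \<and> (\<forall>x \<in> set xs. g x = f x))"
    using Cons by auto
  show ?case
  proof
    assume "r \<in> set (ext (assign f xs) (v # W))"
    then obtain r' c where r: "r = (v, c) # r'" "r' \<in> set (ext (assign f xs) W)"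
        "c \<in> set (Opt v)" "\<not> conf r' v c" by auto
    then obtain g where g: "r' = assign g (W @ xs)" "feas g (set (W @ xs))" "\<forall>x \<in> set xs. g x = f x"
      using IH by blast
    let ?g = "g(v := c)"
    have eq: "\<And>x. x \<in> set (W @ xs) \<Longrightarrow> ?g x = g x" using v by auto
    have a1: "feas ?g (set (W @ xs))" by (rule iffD2[OF feas_cong g(2)]) (rule eq)
    have a2: "(\<exists>u \<in> set (W @ xs). ?g u = c \<and> E v u) \<longleftrightarrow> (\<exists>u \<in> set (W @ xs). g u = c \<and> E v u)"
      by (rule bex_cong[OF refl]) (simp only: eq)
    have a3: "\<not> (c \<noteq> 0 \<and> (\<exists>u \<in> set (W @ xs). g u = c \<and> E v u))"
      using r(4) unfolding g(1) conf_assign .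
    have "feas ?g (insert v (set (W @ xs)))"
      unfolding feas_insert fun_upd_same a2 by (intro conjI a1 r(3) a3)
    then have 1: "feas ?g (set ((v # W) @ xs))" by simp
    have "assign ?g (W @ xs) = assign g (W @ xs)" by (rule assign_cong) (rule eq)
    then have 2: "r = assign ?g ((v # W) @ xs)"
      unfolding r(1) g(1) append_Cons assign_simps fun_upd_same by simp
    have 3: "\<forall>x \<in> set xs. ?g x = f x" using g(3) v by auto
    show "\<exists>g. r = assign g ((v # W) @ xs) \<and> feas g (set ((v # W) @ xs)) \<and>
        (\<forall>x \<in> set xs. g x = f x)" by (rule exI[of _ ?g], intro conjI) (fact 2, fact 1, fact 3)
  next
    assume "\<exists>g. r = assign g ((v # W) @ xs) \<and> feas g (set ((v # W) @ xs)) \<and>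
        (\<forall>x \<in> set xs. g x = f x)"
    then obtain g where g: "r = assign g ((v # W) @ xs)" "feas g (insert v (set (W @ xs)))"
        "\<forall>x \<in> set xs. g x = f x" by auto
    have 1: "assign g (W @ xs) \<in> set (ext (assign f xs) W)"
      using IH g(2,3) feas_insert by blast
    have 2: "g v \<in> set (Opt v)" "\<not> conf (assign g (W @ xs)) v (g v)"
      using g(2) unfolding feas_insert conf_assign by auto
    have "r \<in> set (map (\<lambda>c. (v, c) # assign g (W @ xs))
        (filter (\<lambda>c. \<not> conf (assign g (W @ xs)) v c) (Opt v)))"
      using 2 g(1) by simp
    then show "r \<in> set (ext (assign f xs) (v # W))"
      unfolding ext.simps by (rule in_set_concat_map[OF 1])
  qed
qed

section \<open>Optimal extensions of fixed values, and the completion over components\<close>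

text \<open>Optimality relative to the values already decided on \<open>X\<close>. The recursion
  enlarges \<open>X\<close>; with \<open>X\<close> empty this is the original problem.\<close>

definition optimal :: "nat set \<Rightarrow> nat set \<Rightarrow> (nat \<Rightarrow> nat) \<Rightarrow> (nat \<Rightarrow> nat) \<Rightarrow> bool" where
  "optimal V X f g \<longleftrightarrow> feas g V \<and> (\<forall>x \<in> X. g x = f x) \<and>
     (\<forall>h. feas h V \<longrightarrow> (\<forall>x \<in> X. h x = f x) \<longrightarrow> cost g V \<le> cost h V)"

lemma best_assign:
  assumes "distinct (W @ xs)" "feas f (set xs)"
  obtains g where "best (assign f xs) W = assign g (W @ xs)"
    "optimal (set (W @ xs)) (set xs) f g"
proof -
  note iff = ext_assign_iff[OF assms]
  have "best (assign f xs) W \<in> set (ext (assign f xs) W)"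
    unfolding best_def by (rule amin_mem[OF ext_ne])
  then obtain g where g: "best (assign f xs) W = assign g (W @ xs)" "feas g (set (W @ xs))"
      "\<forall>x \<in> set xs. g x = f x"
    unfolding iff by blast
  have "cost g (set (W @ xs)) \<le> cost h (set (W @ xs))"
    if "feas h (set (W @ xs))" "\<forall>x \<in> set xs. h x = f x" for h
  proof -
    have "assign h (W @ xs) \<in> set (ext (assign f xs) W)" unfolding iff using that by blast
    then have "zeros (best (assign f xs) W) \<le> zeros (assign h (W @ xs))"
      unfolding best_def by (rule amin_le)
    then show ?thesis unfolding g(1) zeros_assign[OF assms(1)] .
  qed
  with g show ?thesis by (intro that[of g]) (auto simp: optimal_def)
qed

abbreviation separated :: "nat list list \<Rightarrow> bool" where
  "separated \<equiv> sorted_wrt (\<lambda>C D. \<forall>x \<in> set C. \<forall>y \<in> set D. \<not> E x y)"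

text \<open>Once the hub is decided the components do not interact, so the greedy completion is
  optimal: any competitor can adopt the greedy choice on the first component without disturbing the
  others.\<close>

lemma finish_assign:
  assumes "distinct (concat Cs @ xs)" "feas f (set xs)" "separated Cs"
  shows "\<exists>g ys. finish Cs (assign f xs) = assign g ys \<and> distinct ys \<and>
    set ys = set (concat Cs) \<union> set xs \<and> optimal (set ys) (set xs) f g"
  using assms
proof (induction Cs arbitrary: f xs)
  case Nil
  then show ?case by (intro exI[of _ f] exI[of _ xs]) (auto simp: optimal_def intro!: cost_cong eq_refl)
next
  case (Cons C Cs)
  let ?U = "set (C @ xs)"
  have d: "distinct (C @ xs)" "distinct (concat Cs @ C @ xs)" using Cons.prems(1) by auto
  obtain g1 where g1: "best (assign f xs) C = assign g1 (C @ xs)" "optimal ?U (set xs) f g1"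
    using best_assign[OF d(1) Cons.prems(2)] by blast
  obtain g ys where g: "finish Cs (assign g1 (C @ xs)) = assign g ys" "distinct ys"
      "set ys = set (concat Cs) \<union> ?U" "optimal (set ys) ?U g1 g"
    using Cons.IH[OF d(2), of g1] g1(2) Cons.prems(3) unfolding optimal_def by auto
  have "cost g (set ys) \<le> cost h (set ys)" if h: "feas h (set ys)" "\<forall>x \<in> set xs. h x = f x" for h
  proof -
    \<comment> \<open>The competitor after adopting \<open>g1\<close> on \<open>?U\<close>; it now
      has the values that \<open>g\<close> is optimal for.\<close>
    let ?h = "\<lambda>x. if x \<in> ?U then g1 x else h x"
    have sub: "?U \<subseteq> set ys" using g(3) by simp
    have "feas ?h (set ys)"
    proof (rule feas_patch[OF _ h(1) sub])
      show "feas g1 ?U" using g1(2) by (simp add: optimal_def)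
      fix u w assume uw: "u \<in> ?U" "w \<in> set ys - ?U" "E u w"
      then have "w \<in> set (concat Cs)" using g(3) by blast
      then have "u \<notin> set C" using uw(3) Cons.prems(3) by auto
      then have "u \<in> set xs" using uw(1) by simp
      then show "g1 u = h u \<or> g1 u = 0" using g1(2) h(2) by (simp add: optimal_def)
    qed
    then have "cost g (set ys) \<le> cost ?h (set ys)" using g(4) by (simp add: optimal_def)
    also have "\<dots> = cost ?h ?U + cost ?h (set ys - ?U)"
      by (rule cost_subset_split[OF _ sub]) simp
    also have "cost ?h ?U = cost g1 ?U" by (rule cost_cong) simp
    also have "cost ?h (set ys - ?U) = cost h (set ys - ?U)" by (rule cost_cong) simp
    also have "cost g1 ?U \<le> cost h ?U"
      using g1(2) h feas_subset[OF h(1) sub] by (simp add: optimal_def)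
    also have "cost h ?U + cost h (set ys - ?U) = cost h (set ys)"
      by (rule cost_subset_split[symmetric, OF _ sub]) simp
    finally show ?thesis by simp
  qed
  then have "optimal (set ys) (set xs) f g"
    using g(4) g1(2) unfolding optimal_def by simp
  then show ?case using g g1(1) by (intro exI[of _ g] exI[of _ ys]) auto
qed

section \<open>Exchange arguments for the branching and forcing rules\<close>

text \<open>All neighbours of \<open>C\<close> in the rest of \<open>V\<close> lie in
  \<open>v # xs\<close>, so the comparison of local optima carries over to \<open>V\<close>. The
  swap changes values only on \<open>C\<close> and at \<open>v\<close>, and the new value 0 at
  \<open>v\<close> clashes with nothing, whatever other neighbours \<open>v\<close> has.\<close>

lemma dominated_replace:
  assumes V: "finite V" "feas h V" and U: "set (C @ v # xs) \<subseteq> V" "distinct (C @ v # xs)"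
    and iso: "\<And>x w. x \<in> set C \<Longrightarrow> w \<in> V - set (C @ v # xs) \<Longrightarrow> \<not> E x w"
    and dom: "dominated C (assign h (v # xs))"
  obtains h' where "feas h' V" "h' v = 0" "\<And>x. x \<in> set xs \<Longrightarrow> h' x = h x" "cost h' V \<le> cost h V"
proof -
  let ?U = "set (C @ v # xs)"
  let ?f = "h(v := 0)"
  have fU: "feas h ?U" by (rule feas_subset[OF V(2) U(1)])
  have fh: "feas h (set (v # xs))" by (rule feas_subset[OF fU]) auto
  have ff: "feas ?f (set (v # xs))" by (rule feas_delete[OF fh])
  obtain g0 where g0: "best (assign ?f (v # xs)) C = assign g0 (C @ v # xs)"
      "optimal ?U (set (v # xs)) ?f g0"
    using best_assign[OF U(2) ff] by blast
  obtain g1 where g1: "best (assign h (v # xs)) C = assign g1 (C @ v # xs)"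
      "optimal ?U (set (v # xs)) h g1"
    using best_assign[OF U(2) fh] by blast
  have "assign ?f (v # xs) = (v, 0) # assign h xs"
    using U(2) by (auto intro: assign_cong)
  then have "zeros (best (assign ?f (v # xs)) C) \<le> zeros (best (assign h (v # xs)) C)"
    using dom by (simp add: dominated_def)
  then have le: "cost g0 ?U \<le> cost g1 ?U"
    unfolding g0(1) g1(1) zeros_assign[OF U(2)] .
  \<comment> \<open>\<open>h\<close> itself is among the competitors of \<open>g1\<close>.\<close>
  also have "cost g1 ?U \<le> cost h ?U" using g1(2) fU by (simp add: optimal_def)
  finally have le: "cost g0 ?U \<le> cost h ?U" .
  let ?h = "\<lambda>x. if x \<in> ?U then g0 x else h x"
  have g0v: "g0 v = 0" and g0x: "g0 x = h x" if "x \<in> set xs" for x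
    using g0(2) that U(2) by (auto simp: optimal_def)
  have g0v: "g0 v = 0" using g0(2) by (simp add: optimal_def)
  have "feas ?h V"
  proof (rule feas_patch[OF _ V(2) U(1)])
    show "feas g0 ?U" using g0(2) by (simp add: optimal_def)
    fix u w assume "u \<in> ?U" "w \<in> V - ?U" "E u w"
    then show "g0 u = h u \<or> g0 u = 0" using iso g0v g0x by auto
  qed
  moreover have "cost ?h V \<le> cost h V"
  proof -
    have "cost ?h V = cost ?h ?U + cost ?h (V - ?U)" by (rule cost_subset_split[OF V(1) U(1)])
    also have "cost ?h ?U = cost g0 ?U" by (rule cost_cong) simp
    also have "cost ?h (V - ?U) = cost h (V - ?U)" by (rule cost_cong) simp
    also have "cost g0 ?U + cost h (V - ?U) \<le> cost h ?U + cost h (V - ?U)" using le by simp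
    also have "\<dots> = cost h V" by (rule cost_subset_split[symmetric, OF V(1) U(1)])
    finally show ?thesis .
  qed
  ultimately show ?thesis using g0v g0x by (intro that[of ?h]) auto
qed

text \<open>The test failed also for the values that \<open>h\<close> takes on \<open>S\<close>, so
  colouring \<open>v\<close> leaves strictly fewer deletions than deleting it. The unit for
  \<open>v\<close> cancels, and the deletions inside \<open>C\<close> do not increase, even if
  \<open>h\<close> gives \<open>v\<close> another colour.\<close>

lemma not_useful_replace:
  assumes h: "feas h (set (C @ v # S @ xs))" and d: "distinct (C @ v # S @ xs)"
    and f: "feas f (set xs)" "\<And>x. x \<in> set xs \<Longrightarrow> h x = f x"
    and nu: "\<not> useful v C (ext (assign f xs) S)"
  obtains g where "feas g (set (C @ v # S @ xs))" "g v = hd (Opt v)"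
    "\<And>x. x \<in> set (S @ xs) \<Longrightarrow> g x = h x" "cost g (set C) \<le> cost h (set C)"
proof -
  let ?a = "hd (Opt v)" and ?X = "set (S @ xs)" and ?U = "set (C @ v # S @ xs)"
  have vX: "v \<notin> ?X" "set C \<inter> insert v ?X = {}" "v \<notin> set C" using d by auto
  have dS: "distinct (S @ xs)" using d by simp
  have hX: "feas h ?X" by (rule feas_subset[OF h]) auto
  have b: "assign h (S @ xs) \<in> set (ext (assign f xs) S)"
    unfolding ext_assign_iff[OF dS f(1)] using hX f(2) by blast
  have nc: "\<not> conf (assign h (S @ xs)) v ?a" and nd: "\<not> dominated C ((v, ?a) # assign h (S @ xs))"
    using nu b unfolding useful_def by blast+
  have split: "cost k ?U = cost k (set C) + ((if k v = 0 then 1 else 0) + cost k ?X)" for k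
    using cost_Un[of "set C" "insert v ?X" k] cost_insert[of ?X v k] vX by (simp add: Un_commute)
  have upd: "assign (h(v := c)) (v # S @ xs) = (v, c) # assign h (S @ xs)" for c
    using vX(1) by (auto intro!: assign_cong)
  have fa: "feas (h(v := ?a)) (set (v # S @ xs))"
  proof -
    have "feas (h(v := ?a)) ?X" using hX vX(1) by (subst feas_cong[of _ _ h]) auto
    moreover have "\<not> (?a \<noteq> 0 \<and> (\<exists>u \<in> ?X. (h(v := ?a)) u = ?a \<and> E v u))"
      using nc vX(1) unfolding conf_assign by (metis fun_upd_apply)
    ultimately have "feas (h(v := ?a)) (insert v ?X)"
      unfolding feas_insert by simp
    then show ?thesis by simp
  qed
  \<comment> \<open>Deleting \<open>v\<close> in \<open>h\<close> is the common reference: it leaves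
    the cost on \<open>C\<close> unchanged, whatever \<open>h\<close> does at
    \<open>v\<close>.\<close>
  have h0: "feas (h(v := 0)) ?U" by (rule feas_delete[OF h])
  have f0: "feas (h(v := 0)) (set (v # S @ xs))" by (rule feas_subset[OF h0]) auto
  obtain g0 where g0: "best (assign (h(v := 0)) (v # S @ xs)) C = assign g0 (C @ v # S @ xs)"
      "optimal ?U (set (v # S @ xs)) (h(v := 0)) g0"
    using best_assign[OF d f0] by blast
  obtain g where g: "best (assign (h(v := ?a)) (v # S @ xs)) C = assign g (C @ v # S @ xs)"
      "optimal ?U (set (v # S @ xs)) (h(v := ?a)) g"
    using best_assign[OF d fa] by blast
  have gv: "g v = ?a" and gX: "\<And>x. x \<in> ?X \<Longrightarrow> g x = h x"
    using g(2) vX(1) by (auto simp: optimal_def)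
  have cX: "cost g ?X = cost h ?X" by (rule cost_cong) (rule gX)
  have cX': "cost (h(v := 0)) ?X = cost h ?X" "cost (h(v := 0)) (set C) = cost h (set C)"
    using vX by (auto intro!: cost_cong)
  have h0c: "cost (h(v := 0)) ?U = cost h (set C) + (1 + cost h ?X)"
    unfolding split cX' by simp
  have "cost g (set C) \<le> cost h (set C)"
  proof (cases "?a = 0")
    \<comment> \<open>Domination says nothing about the option 0, but here \<open>g\<close> and
      \<open>h(v := 0)\<close> extend the same fixed values, so optimality of \<open>g\<close> is
      enough.\<close>
    case True
    then have "cost g ?U \<le> cost (h(v := 0)) ?U"
      using g(2) h0 by (simp add: optimal_def)
    then show ?thesis unfolding h0c unfolding split cX using gv True by simp
  next
    case False
    have "zeros (best (assign (h(v := ?a)) (v # S @ xs)) C)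
        < zeros (best (assign (h(v := 0)) (v # S @ xs)) C)"
      using nd False unfolding upd by (simp add: dominated_def)
    then have "cost g ?U < cost g0 ?U"
      unfolding g0(1) g(1) zeros_assign[OF d] .
    also have "cost g0 ?U \<le> cost (h(v := 0)) ?U"
      using g0(2) h0 by (simp add: optimal_def)
    finally show ?thesis unfolding h0c unfolding split cX using gv False by simp
  qed
  moreover have "feas g ?U" using g(2) by (simp add: optimal_def)
  ultimately show ?thesis using gv gX by (intro that[of g]) auto
qed

lemma cost_concat_mono:
  assumes "distinct (concat Cs)" "\<And>C. C \<in> set Cs \<Longrightarrow> cost g (set C) \<le> cost h (set C)"
  shows "cost g (set (concat Cs)) \<le> cost h (set (concat Cs))"
  using assms
proof (induction Cs)
  case (Cons C Cs)
  have e: "cost k (set (concat (C # Cs))) = cost k (set C) + cost k (set (concat Cs))" for k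
    unfolding concat.simps set_append using Cons.prems(1) by (intro cost_Un) auto
  have "cost g (set C) \<le> cost h (set C)" using Cons.prems(2) by simp
  moreover have "cost g (set (concat Cs)) \<le> cost h (set (concat Cs))"
    using Cons.prems by (intro Cons.IH) auto
  ultimately show ?case unfolding e by simp
qed (simp add: cost_def)

lemma separated_mem:
  assumes "separated Cs" "C \<in> set Cs" "D \<in> set Cs" "x \<in> set C" "y \<in> set D" "E x y"
  shows "C = D"
proof -
  obtain i j where ij: "i < length Cs" "C = Cs ! i" "j < length Cs" "D = Cs ! j"
    using assms(2,3) by (metis in_set_conv_nth)
  consider "i < j" | "j < i" | "i = j" by linarith
  then show ?thesis
  proof cases
    case 1
    then show ?thesis using sorted_wrt_nth_less[OF assms(1) 1 ij(3)] ij assms by blast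
  next
    case 2
    then show ?thesis using sorted_wrt_nth_less[OF assms(1) 2 ij(1)] ij assms E_sym by blast
  qed (use ij in simp)
qed

lemma distinct_concat_mem:
  assumes "distinct (concat Cs)" "C \<in> set Cs" "D \<in> set Cs" "x \<in> set C" "x \<in> set D"
  shows "C = D"
  using assms
proof (induction Cs)
  case (Cons B Cs)
  then show ?case by (auto simp: disjoint_iff)
qed simp

text \<open>Common to both branching rules. Dropping branches is harmless when every feasible
  \<open>h\<close> has a replacement that is no dearer and whose restriction is still in
  \<open>bs\<close>: its child does at least as well as the replacement, and \<open>amin\<close> at
  least as well as that child.\<close>

lemma branch_assign:
  assumes ne: "bs \<noteq> []"
    and child: "\<And>b. b \<in> set bs \<Longrightarrow> \<exists>g0 g ys. b = assign g0 (W @ xs) \<and> (\<forall>x \<in> set xs. g0 x = f x) \<and>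
      solve Cs b R = assign g ys \<and> distinct ys \<and> set ys = V \<and> optimal V (set (W @ xs)) g0 g"
    and complete: "\<And>h. feas h V \<Longrightarrow> \<forall>x \<in> set xs. h x = f x \<Longrightarrow>
      \<exists>h'. feas h' V \<and> cost h' V \<le> cost h V \<and> assign h' (W @ xs) \<in> set bs"
  shows "\<exists>g ys. amin (map (\<lambda>b. solve Cs b R) bs) = assign g ys \<and> distinct ys \<and> set ys = V \<and>
    optimal V (set xs) f g"
proof -
  let ?r = "amin (map (\<lambda>b. solve Cs b R) bs)"
  have "?r \<in> set (map (\<lambda>b. solve Cs b R) bs)" using ne by (intro amin_mem) simp
  then obtain b where b: "b \<in> set bs" "?r = solve Cs b R" by auto
  obtain g0 g ys where g: "b = assign g0 (W @ xs)" "\<forall>x \<in> set xs. g0 x = f x"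
      "solve Cs b R = assign g ys" "distinct ys" "set ys = V" "optimal V (set (W @ xs)) g0 g"
    using child[OF b(1)] by blast
  have "cost g V \<le> cost h V" if h: "feas h V" "\<forall>x \<in> set xs. h x = f x" for h
  proof -
    obtain h' where h': "feas h' V" "cost h' V \<le> cost h V" "assign h' (W @ xs) \<in> set bs"
      using complete[OF h] by blast
    obtain g2 g3 ys' where g3: "assign h' (W @ xs) = assign g2 (W @ xs)"
        "solve Cs (assign h' (W @ xs)) R = assign g3 ys'" "distinct ys'" "set ys' = V"
        "optimal V (set (W @ xs)) g2 g3"
      using child[OF h'(3)] by metis
    have "\<forall>x \<in> set (W @ xs). h' x = g2 x" using assign_eqD[OF g3(1)] by blast
    then have "cost g3 V \<le> cost h' V" using g3(5) h'(1) by (simp add: optimal_def)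
    moreover have "zeros ?r \<le> zeros (assign g3 ys')"
      using amin_le[of "assign g3 ys'"] h'(3) g3(2) by (metis image_eqI list.set_map)
    then have "cost g V \<le> cost g3 V"
      unfolding b(2) g(3) using zeros_assign[OF g(4)] zeros_assign[OF g3(3)] g(5) g3(4) by simp
    ultimately show ?thesis using h'(2) by linarith
  qed
  then have "optimal V (set xs) f g" using g(2,6) by (simp add: optimal_def)
  then show ?thesis using b(2) g(3-5) by auto
qed


text \<open>Each component is completed anew by \<open>not_useful_replace\<close>. These completions
  agree with \<open>h\<close> on the relevant hub vertices other than \<open>v\<close>, and
  components are not adjacent, so they glue together.\<close>

lemma forced_replace:
  assumes V: "V = set (concat Cs) \<union> insert v (set H \<union> set xs)"
    and d: "distinct (concat Cs @ (v # H) @ xs)"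
    and f: "feas f (set xs)" and sep: "separated Cs" and Nil: "[] \<in> set Cs"
    and no_edge: "\<And>y. y \<in> set H \<Longrightarrow> \<not> E v y"
    and nu: "\<And>C. C \<in> set Cs \<Longrightarrow> \<not> useful v C (ext (assign f xs) (filter (touches C) H))"
    and h: "feas h V" "\<And>x. x \<in> set xs \<Longrightarrow> h x = f x"
  obtains h' where "feas h' V" "h' v = hd (Opt v)" "\<And>x. x \<in> set xs \<Longrightarrow> h' x = f x"
    "cost h' V \<le> cost h V"
proof -
  let ?K = "set (concat Cs)" and ?S = "\<lambda>C. filter (touches C) H" and ?a = "hd (Opt v)"
  let ?U = "\<lambda>C. set (C @ v # ?S C @ xs)"
  have dK: "distinct (concat Cs)" using d by simp
  have CK: "set C \<subseteq> ?K" if "C \<in> set Cs" for C using that by auto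
  have disj: "x \<notin> insert v (set H \<union> set xs)" if "x \<in> ?K" for x
    using d that by auto
  have UV: "?U C \<subseteq> V" if "C \<in> set Cs" for C
    using CK[OF that] unfolding V by auto
  have "\<forall>C \<in> set Cs. \<exists>g. feas g (?U C) \<and> g v = ?a \<and> (\<forall>x \<in> set (?S C @ xs). g x = h x) \<and>
      cost g (set C) \<le> cost h (set C)"
  proof
    fix C assume C: "C \<in> set Cs"
    have "distinct C" using dK C by (simp add: distinct_concat_iff)
    moreover have "set C \<inter> insert v (set H \<union> set xs) = {}" using disj CK[OF C] by blast
    ultimately have dC: "distinct (C @ v # ?S C @ xs)" using d by auto
    show "\<exists>g. feas g (?U C) \<and> g v = ?a \<and> (\<forall>x \<in> set (?S C @ xs). g x = h x) \<and>
      cost g (set C) \<le> cost h (set C)"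
      by (rule not_useful_replace[OF feas_subset[OF h(1) UV[OF C]] dC f h(2) nu[OF C]])
         (assumption, rule exI, intro conjI ballI, assumption+)
  qed
  from bchoice[OF this] obtain G where G: "\<And>C. C \<in> set Cs \<Longrightarrow> feas (G C) (?U C)"
      "\<And>C. C \<in> set Cs \<Longrightarrow> G C v = ?a"
      "\<And>C x. C \<in> set Cs \<Longrightarrow> x \<in> set (?S C @ xs) \<Longrightarrow> G C x = h x"
      "\<And>C. C \<in> set Cs \<Longrightarrow> cost (G C) (set C) \<le> cost h (set C)"
    by auto
  \<comment> \<open>Distinctness of \<open>concat Cs\<close> makes the choice unique for vertices of
    the components, so the glued solution can be defined pointwise.\<close>
  define part where "part x = (SOME C. C \<in> set Cs \<and> x \<in> set C)" for x
  have part: "part x = C" if "C \<in> set Cs" "x \<in> set C" for C x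
    unfolding part_def
    by (rule some_equality) (use that distinct_concat_mem[OF dK] in auto)
  define h' where "h' x = (if x = v then ?a else if x \<in> ?K then G (part x) x else h x)" for x
  have h'_hub: "h' x = h x" if "x \<in> set H \<union> set xs" for x
    unfolding h'_def using that disj d by auto
  have h'_v: "h' v = ?a" by (simp add: h'_def)
  have h'_C: "h' x = G C x" if "C \<in> set Cs" "x \<in> set C" for C x
    unfolding h'_def using that part[OF that] CK[OF that(1)] disj[of x] by auto
  have h'_U: "h' x = G C x" if C: "C \<in> set Cs" and x: "x \<in> ?U C" for C x
  proof -
    consider "x \<in> set C" | "x = v" | "x \<in> set (?S C @ xs)" using x by auto
    then show ?thesis
    proof cases
      case 1
      then show ?thesis by (rule h'_C[OF C])
    next
      case 2
      then show ?thesis using h'_v G(2)[OF C] by simp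
    next
      case 3
      then have "x \<in> set H \<union> set xs" by auto
      then show ?thesis using h'_hub G(3)[OF C 3] by simp
    qed
  qed
  have in_U: "h' x = 0" if "C \<in> set Cs" "x \<in> ?U C" "y \<in> ?U C" "E x y" "h' x = h' y" for C x y
    using feasD[OF G(1)[OF that(1)] that(2-4)] that(5) h'_U[OF that(1,2)] h'_U[OF that(1,3)] by simp
  \<comment> \<open>An edge with an end in a component \<open>C\<close> stays inside
    \<open>?U C\<close>, where \<open>h'\<close> coincides with the single feasible function
    \<open>G C\<close>.\<close>
  have e1: "h' x = 0" if x: "x \<in> ?K" and y: "y \<in> V" "E x y" "h' x = h' y" for x y
  proof -
    obtain C where C: "C \<in> set Cs" "x \<in> set C" using x by auto
    have "y \<in> ?U C"
    proof (cases "y \<in> ?K")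
      case True
      then obtain D where D: "D \<in> set Cs" "y \<in> set D" by auto
      then have "C = D" by (intro separated_mem[OF sep C(1) D(1) C(2) D(2) y(2)])
      then show ?thesis using D by simp
    next
      case False
      then have "y \<in> insert v (set H \<union> set xs)" using y(1) unfolding V by simp
      moreover have "touches C y" using C(2) E_sym[OF y(2)] by (auto simp: touches_def)
      ultimately show ?thesis by auto
    qed
    then show ?thesis using C by (intro in_U[OF C(1) _ _ y(2,3)]) auto
  qed
  \<comment> \<open>For an edge from \<open>v\<close> into the hub the empty part takes the place of
    the component: \<open>?U []\<close> consists of \<open>v\<close> and the decided
    vertices.\<close>
  have e2: "h' v = 0" if y: "y \<in> insert v (set H \<union> set xs)" "E v y" "h' v = h' y" for y
  proof -
    have "y \<in> set xs" using y(1,2) no_edge[of y] E_irrefl[of v] by auto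
    then show ?thesis by (intro in_U[OF Nil _ _ y(2,3)]) auto
  qed
  have "feas h' V"
  proof (rule feasI)
    fix x assume x: "x \<in> V"
    show "h' x \<in> set (Opt x)"
    proof (cases "x \<in> ?K")
      case True
      then obtain C where C: "C \<in> set Cs" "x \<in> set C" by auto
      then show ?thesis using feas_Opt[OF G(1)[OF C(1)], of x] h'_C[OF C] by simp
    next
      case False
      then show ?thesis using x feas_Opt[OF h(1) x] unfolding h'_def by simp
    qed
  next
    fix x y assume xy: "x \<in> V" "y \<in> V" "E x y" "h' x = h' y"
    consider "x \<in> ?K" | "y \<in> ?K" | "x \<notin> ?K" "y \<notin> ?K" "x = v" | "x \<notin> ?K" "y \<notin> ?K" "y = v"
      | "x \<notin> ?K" "y \<notin> ?K" "x \<noteq> v" "y \<noteq> v" by argo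
    then show "h' x = 0"
    proof cases
      case 1
      then show ?thesis by (rule e1[OF _ xy(2-4)])
    next
      case 2
      then have "h' y = 0" by (rule e1[OF _ xy(1) E_sym[OF xy(3)] xy(4)[symmetric]])
      then show ?thesis using xy(4) by simp
    next
      case 3
      then show ?thesis using e2[of y] xy unfolding V by simp
    next
      case 4
      then show ?thesis using e2[of x] xy E_sym[OF xy(3)] unfolding V by simp
    next
      case 5
      then have "h' x = h x" "h' y = h y" using xy(1,2) unfolding V by (auto intro: h'_hub)
      then show ?thesis using feasD[OF h(1) xy(1-3)] xy(4) by simp
    qed
  qed
  moreover have "h' x = f x" if "x \<in> set xs" for x
    using h'_hub[of x] h(2)[OF that] that by simp
  moreover have "cost h' V \<le> cost h V"
  proof -
    let ?X = "set H \<union> set xs"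
    have vX: "v \<notin> ?X" using d by auto
    have split: "cost k V = cost k ?K + ((if k v = 0 then 1 else 0) + cost k ?X)" for k
      unfolding V cost_insert[OF _ vX, simplified, symmetric]
      by (rule cost_Un) (use disj in auto)
    have "cost h' ?K \<le> cost h ?K"
    proof (rule cost_concat_mono[OF dK])
      fix C assume C: "C \<in> set Cs"
      have "cost h' (set C) = cost (G C) (set C)" by (rule cost_cong) (rule h'_C[OF C])
      then show "cost h' (set C) \<le> cost h (set C)" using G(4)[OF C] by simp
    qed
    moreover have "cost h' ?X = cost h ?X" by (rule cost_cong) (rule h'_hub)
    \<comment> \<open>If the forced option is deletion, \<open>hd_Opt\<close> left \<open>h\<close>
      no alternative, so no new deletion is charged at \<open>v\<close>.\<close>
    moreover have "h v = 0" if "h' v = 0"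
      using hd_Opt[of v] that h'_v feas_Opt[OF h(1), of v] unfolding V by simp
    ultimately show ?thesis unfolding split by auto
  qed
  ultimately show ?thesis using h'_v by (intro that[of h'])
qed

theorem solve_assign:
  assumes "distinct (concat Cs @ H @ xs)" "feas f (set xs)" "separated Cs" "[] \<in> set Cs"
  shows "\<exists>g ys. solve Cs (assign f xs) H = assign g ys \<and> distinct ys \<and>
    set ys = set (concat Cs) \<union> set H \<union> set xs \<and> optimal (set ys) (set xs) f g"
  using assms(1,2)
proof (induction "length H" arbitrary: f xs H rule: less_induct)
  case less
  note d = less.prems(1) and f = less.prems(2)
  show ?case
  proof (cases H)
    case Nil
    then show ?thesis using finish_assign[OF _ f assms(3)] d by simp
  next
    case (Cons v H')
    let ?s = "assign f xs"
    define V where "V = set (concat Cs) \<union> set H \<union> set xs"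
    have V': "V = set (concat Cs) \<union> insert v (set H' \<union> set xs)" unfolding V_def Cons by auto
    have finV: "finite V" unfolding V_def by simp
    have child: "\<exists>g0 g ys. b = assign g0 (W @ xs) \<and> (\<forall>x \<in> set xs. g0 x = f x) \<and>
      solve Cs b R = assign g ys \<and> distinct ys \<and> set ys = V \<and> optimal V (set (W @ xs)) g0 g"
      if b: "b \<in> set (ext ?s W)" and l: "length R < length H" and HW: "set H = set W \<union> set R"
        and dW: "distinct (W @ R)" for b W R
    proof -
      have dx: "distinct (W @ xs)" "distinct (concat Cs @ R @ (W @ xs))"
        using d dW HW by auto
      obtain g0 where g0: "b = assign g0 (W @ xs)" "feas g0 (set (W @ xs))" "\<forall>x \<in> set xs. g0 x = f x"
        using b unfolding ext_assign_iff[OF dx(1) f] by blast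
      have e: "set (concat Cs) \<union> set R \<union> set (W @ xs) = V" unfolding V_def HW by auto
      show ?thesis using less.hyps[OF l dx(2) g0(2)] g0 unfolding e by auto
    qed
    consider u S where "filter (E v) H' = u # S"
      | C D where "filter (E v) H' = []" "pieces Cs ?s v H' = C # D"
      | "filter (E v) H' = []" "pieces Cs ?s v H' = []"
      by (meson list.exhaust)
    then have "\<exists>g ys. solve Cs ?s H = assign g ys \<and> distinct ys \<and> set ys = V \<and>
        optimal V (set xs) f g"
    proof cases
      case 1
      let ?R = "S @ filter (\<lambda>y. \<not> E v y) H'"
      let ?W = "[v, u]"
      have fs: "set (u # S) = {y \<in> set H'. E v y}" unfolding 1[symmetric] by simp
      have "distinct (filter (E v) H')" using d Cons by simp
      then have dS: "distinct (u # S)" unfolding 1 .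
      have l: "length ?R < length H" using length_filter_Cons_compl[OF 1] Cons by simp
      have HW: "set H = set ?W \<union> set ?R" unfolding Cons using fs by auto
      have dW: "distinct (?W @ ?R)" using d dS fs unfolding Cons by auto
      have dx: "distinct (?W @ xs)" using d dW HW by auto
      have "\<exists>g ys. amin (map (\<lambda>b. solve Cs b ?R) (ext ?s ?W)) = assign g ys \<and> distinct ys \<and>
          set ys = V \<and> optimal V (set xs) f g"
      proof (rule branch_assign[where W = ?W])
        fix h assume h: "feas h V" "\<forall>x \<in> set xs. h x = f x"
        have "feas h (set (?W @ xs))" by (rule feas_subset[OF h(1)]) (auto simp: V_def HW)
        then have "assign h (?W @ xs) \<in> set (ext ?s ?W)"
          unfolding ext_assign_iff[OF dx f] using h(2) by blast
        then show "\<exists>h'. feas h' V \<and> cost h' V \<le> cost h V \<and> assign h' (?W @ xs) \<in> set (ext ?s ?W)"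
          using h(1) by (intro exI[of _ h] conjI) (assumption, rule order_refl, assumption)
      qed (rule ext_ne, rule child[OF _ l HW dW], assumption)
      moreover have "solve Cs ?s H = amin (map (\<lambda>b. solve Cs b ?R) (ext ?s ?W))"
        unfolding Cons solve.simps 1 by (simp only: list.case)
      ultimately show ?thesis by (simp only:)
    next
      case (2 C Ds)
      let ?S = "filter (touches C) H'"
      let ?R = "filter (\<lambda>y. \<not> touches C y) H'"
      let ?W = "v # ?S"
      let ?bs = "filter (\<lambda>r. \<not> dominated C r) (ext ?s ?W)"
      have C: "C \<in> set Cs"
        using 2(2) unfolding pieces_def by (metis set_dropWhileD list.set_intros(1))
      have l: "length ?R < length H" using Cons by (simp add: le_imp_less_Suc)
      have HW: "set H = set ?W \<union> set ?R" unfolding Cons by auto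
      have dW: "distinct (?W @ ?R)" using d unfolding Cons by auto
      have dx: "distinct (?W @ xs)" using d unfolding Cons by auto
      have WV: "set (?W @ xs) \<subseteq> V" unfolding V' by auto
      have CV: "set (C @ v # ?S @ xs) \<subseteq> V" using C unfolding V' by auto
      have dC: "distinct (C @ v # ?S @ xs)"
      proof -
        have "distinct C" using d C by (simp add: distinct_concat_iff)
        moreover have "set C \<inter> (set H \<union> set xs) = {}" using d C by auto
        ultimately show ?thesis using dx unfolding Cons by auto
      qed
      have "\<exists>g ys. amin (map (\<lambda>b. solve Cs b ?R) ?bs) = assign g ys \<and> distinct ys \<and>
          set ys = V \<and> optimal V (set xs) f g"
      proof (rule branch_assign[where W = ?W])
        fix b assume "b \<in> set ?bs"
        then have "b \<in> set (ext ?s ?W)" by (simp del: ext.simps)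
        then show "\<exists>g0 g ys. b = assign g0 (?W @ xs) \<and> (\<forall>x \<in> set xs. g0 x = f x) \<and>
          solve Cs b ?R = assign g ys \<and> distinct ys \<and> set ys = V \<and> optimal V (set (?W @ xs)) g0 g"
          by (rule child[OF _ l HW dW])
      next
        fix h assume h: "feas h V" "\<forall>x \<in> set xs. h x = f x"
        have mem: "assign k (?W @ xs) \<in> set (ext ?s ?W)"
          if "feas k V" "\<forall>x \<in> set xs. k x = f x" for k
          unfolding ext_assign_iff[OF dx f] using feas_subset[OF that(1) WV] that(2) by blast
        show "\<exists>h'. feas h' V \<and> cost h' V \<le> cost h V \<and> assign h' (?W @ xs) \<in> set ?bs"
        proof (cases "dominated C (assign h (?W @ xs))")
          case False
          then have "assign h (?W @ xs) \<in> set ?bs" using mem[OF h] by (simp del: ext.simps)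
          then show ?thesis
            using h(1) by (intro exI[of _ h] conjI) (assumption, rule order_refl, assumption)
        next
          \<comment> \<open>One exchange suffices: it deletes \<open>v\<close>, and assignments that
            delete \<open>v\<close> are never dominated, so the result passes the filter.\<close>
          case True
          have iso: "\<not> E x w" if x: "x \<in> set C" and w: "w \<in> V - set (C @ v # ?S @ xs)" for x w
          proof
            assume e: "E x w"
            show False
            proof (cases "w \<in> set (concat Cs)")
              case True
              then obtain D where D: "D \<in> set Cs" "w \<in> set D" by auto
              then have "C = D" by (intro separated_mem[OF assms(3) C D(1) x D(2) e])
              then show False using D w by simp
            next
              case False
              then have "w \<in> set H'" using w unfolding V' by auto
              moreover have "touches C w" using x E_sym[OF e] by (auto simp: touches_def)
              ultimately show False using w by simp
            qed
          qed
          have dom: "dominated C (assign h (v # ?S @ xs))" using True by simp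
          obtain h' where h': "feas h' V" "h' v = 0" "\<And>x. x \<in> set (?S @ xs) \<Longrightarrow> h' x = h x"
              "cost h' V \<le> cost h V"
            by (rule dominated_replace[OF finV h(1) CV dC iso dom]) (assumption, assumption, rule that)
          have "assign h' (?W @ xs) \<in> set (ext ?s ?W)"
            by (rule mem[OF h'(1)]) (use h'(3) h(2) in simp)
          moreover have "\<not> dominated C (assign h' (?W @ xs))"
            using h'(2) by (simp add: dominated_def)
          ultimately have "assign h' (?W @ xs) \<in> set ?bs" by (simp del: ext.simps)
          then show ?thesis using h'(1,4) by (intro exI[of _ h'] conjI)
        qed
      qed (rule undominated_ne)
      moreover have "solve Cs ?s H = amin (map (\<lambda>b. solve Cs b ?R) ?bs)"
        unfolding Cons solve.simps 2 by (simp only: list.case)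
      ultimately show ?thesis by (simp only:)
    next
      case 3
      let ?a = "hd (Opt v)" and ?f = "f(v := hd (Opt v))"
      have nu: "\<not> useful v C (ext ?s (filter (touches C) H'))" if "C \<in> set Cs" for C
        using 3(2) that unfolding pieces_def by (simp add: dropWhile_eq_Nil_conv)
      have ne: "\<not> E v y" if "y \<in> set H'" for y
        using 3(1) that by (simp add: filter_empty_conv)
      have vx: "v \<notin> set xs" using d Cons by auto
      have dv: "distinct (concat Cs @ (v # H') @ xs)" using d Cons by simp
      \<comment> \<open>For the empty part the failed test involves no component and no undecided
        neighbour; what remains is that \<open>?a\<close> has no conflict with the decided
        vertices.\<close>
      have nc: "\<not> conf ?s v ?a"
        using nu[OF assms(4)] by (simp add: useful_def touches_def)
      have upd: "(v, ?a) # ?s = assign ?f (v # xs)"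
        using vx by (auto intro!: assign_cong)
      have ff: "feas ?f (set (v # xs))"
      proof -
        have 1: "feas ?f (set xs)" by (rule iffD2[OF feas_cong f]) (use vx in auto)
        have "(\<exists>u \<in> set xs. ?f u = ?a \<and> E v u) \<longleftrightarrow> (\<exists>u \<in> set xs. f u = ?a \<and> E v u)"
          by (rule bex_cong[OF refl]) (use vx in auto)
        then have 2: "\<not> (?a \<noteq> 0 \<and> (\<exists>u \<in> set xs. ?f u = ?a \<and> E v u))"
          using nc unfolding conf_assign by simp
        show ?thesis unfolding list.set(2) feas_insert fun_upd_same
          using 2 by (intro conjI 1 hd_in_set Opt_ne)
      qed
      have e: "set (concat Cs) \<union> set H' \<union> set (v # xs) = V" unfolding V' by auto
      have "length H' < length H" "distinct (concat Cs @ H' @ (v # xs))" using d Cons by auto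
      from less.hyps[OF this ff] obtain g ys where g: "solve Cs (assign ?f (v # xs)) H' = assign g ys"
          "distinct ys" "set ys = V" "optimal V (set (v # xs)) ?f g"
        unfolding e by auto
      have gx: "\<forall>x \<in> set xs. g x = f x"
        using g(4) vx by (auto simp: optimal_def)
      \<comment> \<open>A competitor is first moved to one with the forced value at
        \<open>v\<close>; among those \<open>g\<close> is already optimal.\<close>
      have "cost g V \<le> cost h V" if h: "feas h V" "\<forall>x \<in> set xs. h x = f x" for h
      proof -
        have hx: "h x = f x" if "x \<in> set xs" for x using h(2) that by blast
        obtain h' where h': "feas h' V" "h' v = ?a" "\<And>x. x \<in> set xs \<Longrightarrow> h' x = f x"
            "cost h' V \<le> cost h V"
          by (rule forced_replace[OF V' dv f assms(3,4) ne nu h(1) hx])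
            (assumption, assumption, assumption, rule that)
        have "\<forall>x \<in> set (v # xs). h' x = ?f x" using h'(2,3) vx by auto
        then have "cost g V \<le> cost h' V" using g(4) h'(1) by (simp only: optimal_def)
        then show ?thesis using h'(4) by simp
      qed
      then have "optimal V (set xs) f g"
        using g(4) gx by (simp add: optimal_def)
      moreover have "solve Cs ?s H = assign g ys"
        unfolding Cons solve.simps 3 using g(1) upd by (simp only: list.case)
      ultimately show ?thesis using g(2,3) by auto
    qed
    then show ?thesis unfolding V_def by metis
  qed
qed

end

section \<open>Preprocessing and output\<close>

text \<open>The recursion ends in \<open>[0]\<close>, which puts deletion behind all colours: it is
  the head only if no colour is allowed.\<close>

lemma fn_opts:
  "c \<le> Suc q \<Longrightarrow> fn 22 [enc_list (\<lambda>c. enc_bool (P c)) [c..<Suc q], enc_nat c]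
     (enc_list enc_nat (filter P [c..<Suc q] @ [0])) (30 * (Suc q - c) + 30)"
proof (induction rule: inc_induct)
  case base
  show ?case by (simp add: body)
next
  case (step c)
  have u: "[c..<Suc q] = c # [Suc c..<Suc q]" using step(2) by (simp add: upt_conv_Cons del: upt_Suc)
  have "30 * (Suc q - c) = 30 * (Suc q - Suc c) + 30" using step(2) by simp
  then show ?case unfolding u using step(3)
    by (auto simp: body simp del: upt_Suc intro!: fn_call[OF step(3)[unfolded enc_nat.simps]])
qed

context instance_data
begin

text \<open>Incremental connected components: the new vertex merges all parts it is adjacent to. The
  merged part stands first, where the recursion of \<open>add_body\<close> can keep extending
  it.\<close>

definition add_vertex :: "nat \<Rightarrow> nat list list \<Rightarrow> nat list list" where
  "add_vertex w Cs =
     (concat (filter (\<lambda>C. touches C w) Cs) @ [w]) # filter (\<lambda>C. \<not> touches C w) Cs"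

text \<open>The empty part is kept, so that \<^const>\<open>pieces\<close> also notices a conflict of the branching vertex
  with the decided vertices when there are no components.\<close>

primrec parts :: "nat list \<Rightarrow> nat list list" where
  "parts [] = [[]]"
| "parts (w # W) = add_vertex w (parts W)"

lemma fn_add:
  assumes "\<forall>C \<in> set Cs. length C \<le> k"
  shows "fn 20 [encv w, enc_list encvs Cs] (enc_list encvs (add_vertex w Cs))
    ((length Cs + 1) * ((k + 1) * (20 * n + 50) + 20 * k + 100))"
  using assms
proof (induction Cs)
  case Nil
  show ?case by (simp add: body add_vertex_def)
next
  case (Cons C Cs)
  define T where "T = (k + 1) * (20 * n + 50)"
  define h where "h = concat (filter (\<lambda>C. touches C w) Cs) @ [w]"
  have a: "add_vertex w (C # Cs) = (if touches C w then (C @ h) # filter (\<lambda>C. \<not> touches C w) Cs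
      else h # C # filter (\<lambda>C. \<not> touches C w) Cs)"
    by (simp add: add_vertex_def h_def)
  have C: "length C \<le> k" using Cons.prems by simp
  have IH: "fn 20 [encv w, enc_list encvs Cs]
      (Node (encvs h) (enc_list encvs (filter (\<lambda>C. \<not> touches C w) Cs)))
      ((length Cs + 1) * (T + 20 * k + 100))"
    using Cons by (simp add: add_vertex_def T_def h_def)
  have 1: "fn 13 [encv w, encvs C] (enc_bool (touches C w)) T"
    unfolding T_def by (rule fn_mono[OF fn_touches]) (use C in \<open>intro mult_right_mono; simp\<close>)
  have 2: "fn 15 [encvs C, encvs h] (encvs (C @ h)) (20 * k + 20)"
    by (rule fn_mono[OF fn_append]) (use C in simp)
  have e: "(length (C # Cs) + 1) * (T + 20 * k + 100)
      = (length Cs + 1) * (T + 20 * k + 100) + T + 20 * k + 100" by simp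
  show ?case unfolding T_def[symmetric] e a
    by (auto simp: body simp del: mult_Suc intro!: fn_call[OF IH] fn_call[OF 1] fn_call[OF 2])
qed

section \<open>Connected components of the graph without the hub\<close>

lemma mset_filter_concat:
  "mset (concat (filter P Cs)) + mset (concat (filter (\<lambda>C. \<not> P C) Cs)) = mset (concat Cs)"
  by (induction Cs) (auto simp: ac_simps)

text \<open>Merging permutes the vertices, hence multisets; vertex set, distinctness and total
  length all follow from this equation.\<close>

lemma mset_parts: "mset (concat (parts W)) = mset W"
proof (induction W)
  case (Cons w W)
  have "mset (concat (parts (w # W)))
    = add_mset w (mset (concat (filter (\<lambda>C. touches C w) (parts W)))
        + mset (concat (filter (\<lambda>C. \<not> touches C w) (parts W))))"
    by (simp add: add_vertex_def)
  also have "\<dots> = mset (w # W)" unfolding mset_filter_concat Cons by simp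
  finally show ?case .
qed simp

lemma set_parts: "set (concat (parts W)) = set W"
  using mset_parts[of W] by (rule mset_eq_setD)

lemma distinct_parts: "distinct W \<Longrightarrow> distinct (concat (parts W))"
  using mset_eq_imp_distinct_iff[OF mset_parts] by blast

lemma length_concat_parts: "length (concat (parts W)) = length W"
  using mset_parts[of W] by (rule mset_eq_length)

lemma length_parts_mem: "C \<in> set (parts W) \<Longrightarrow> length C \<le> length W"
  using length_concat_parts[of W] member_le_sum_list[of "length C" "map length (parts W)"]
  by (simp add: length_concat)

lemma length_parts: "length (parts W) \<le> length W + 1"
proof (induction W)
  case (Cons w W)
  then show ?case using le_trans[OF length_filter_le Cons] by (simp add: add_vertex_def)
qed simp

lemma Nil_in_parts: "[] \<in> set (parts W)"
  by (induction W) (auto simp: add_vertex_def touches_def)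

text \<open>A part that survives the insertion of \<open>w\<close> is not adjacent to
  \<open>w\<close> and was already separated from the parts that get merged.\<close>

lemma separated_parts: "separated (parts W)"
proof (induction W)
  case (Cons w W)
  let ?P = "parts W"
  have "\<not> E x y" if x: "x \<in> set (concat (filter (\<lambda>C. touches C w) ?P) @ [w])"
    and D: "D \<in> set (filter (\<lambda>C. \<not> touches C w) ?P)" and y: "y \<in> set D" for x D y
  proof
    assume e: "E x y"
    have nD: "\<not> touches D w" "D \<in> set ?P" using D by auto
    show False
    proof (cases "x = w")
      case True
      then show False using nD(1) y e by (auto simp: touches_def)
    next
      case False
      then obtain C where C: "C \<in> set ?P" "touches C w" "x \<in> set C" using x by auto
      then have "C = D" by (intro separated_mem[OF Cons C(1) nD(2) C(3) y e])
      then show False using C nD by simp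
    qed
  qed
  then show ?case using sorted_wrt_filter[OF Cons] by (simp add: add_vertex_def)
qed simp

text \<open>\<open>R\<close> is abstract so that it can become reachability in the graph without the
  hub. Every vertex of the merged part is linked to \<open>w\<close> through a neighbour of
  \<open>w\<close> in its old part.\<close>

lemma parts_connected:
  assumes refl: "\<And>x. x \<in> set W \<Longrightarrow> R x x" and trans: "\<And>x y z. R x y \<Longrightarrow> R y z \<Longrightarrow> R x z"
    and edge: "\<And>x y. x \<in> set W \<Longrightarrow> y \<in> set W \<Longrightarrow> E x y \<Longrightarrow> R x y"
    and C: "C \<in> set (parts W)" "x \<in> set C" "y \<in> set C"
  shows "R x y"
  using assms
proof (induction W arbitrary: C x y)
  case (Cons w W)
  note edge = Cons.prems(3)
  have IH: "R x y" if "C \<in> set (parts W)" "x \<in> set C" "y \<in> set C" for C x y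
    by (rule Cons.IH[OF Cons.prems(1) Cons.prems(2) edge that]) auto
  let ?h = "concat (filter (\<lambda>C. touches C w) (parts W)) @ [w]"
  have w: "R z w \<and> R w z" if z: "z \<in> set ?h" for z
  proof (cases "z = w")
    case True
    then show ?thesis using Cons.prems(1)[of w] by simp
  next
    case False
    then obtain D where D: "D \<in> set (parts W)" "touches D w" "z \<in> set D" using z by auto
    then obtain t where t: "t \<in> set D" "E w t" by (auto simp: touches_def)
    have "t \<in> set W" using set_parts[of W] D(1) t(1) by auto
    then have "R w t" "R t w" using edge[of w t] edge[of t w] t(2) E_sym[OF t(2)] by auto
    then show ?thesis using IH[OF D(1) D(3) t(1)] IH[OF D(1) t(1) D(3)] Cons.prems(2) by blast
  qed
  consider "C = ?h" | "C \<in> set (parts W)" using Cons.prems(4) by (auto simp: add_vertex_def)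
  then show ?case
  proof cases
    case 1
    then show ?thesis using w[of x] w[of y] Cons.prems(2,5,6) by blast
  next
    case 2
    then show ?thesis using IH Cons.prems(5,6) by blast
  qed
qed simp

lemma fn_parts:
  assumes "length W \<le> k"
  shows "fn 21 [encvs W] (enc_list encvs (parts W))
    ((length W + 1) * ((k + 2) * ((k + 1) * (20 * n + 50) + 20 * k + 100) + 50))"
  using assms
proof (induction W)
  case Nil
  show ?case by (simp add: body)
next
  case (Cons w W)
  define T where "T = (k + 2) * ((k + 1) * (20 * n + 50) + 20 * k + 100)"
  have IH: "fn 21 [encvs W] (enc_list encvs (parts W)) ((length W + 1) * (T + 50))"
    using Cons by (simp add: T_def)
  have 1: "fn 20 [encv w, enc_list encvs (parts W)] (enc_list encvs (parts (w # W))) T"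
    unfolding parts.simps T_def
  proof (rule fn_mono[OF fn_add])
    show "\<forall>C \<in> set (parts W). length C \<le> k" using length_parts_mem Cons.prems by fastforce
    show "(length (parts W) + 1) * ((k + 1) * (20 * n + 50) + 20 * k + 100)
      \<le> (k + 2) * ((k + 1) * (20 * n + 50) + 20 * k + 100)"
      using length_parts[of W] Cons.prems by (intro mult_right_mono) auto
  qed
  show ?case unfolding T_def[symmetric]
    by (auto simp: body simp del: parts.simps intro!: fn_call[OF IH] fn_call[OF 1])
qed

text \<open>The input does not number its rows, so the counter supplies the vertex names. The outer
  lists shrink to suffixes while each row stays complete, hence the abstract \<open>row\<close> and
  \<open>lst\<close>.\<close>

lemma fn_split:
  assumes encv: "\<And>v. encv v = Node (enc_nat v) (Node (row v) (enc_list enc_nat (Opt v)))"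
    and opts: "\<And>v. fn 22 [lst v, Node Leaf Leaf] (enc_list enc_nat (Opt v)) (30 * q + 30)"
  shows "i \<le> n \<Longrightarrow> fn 23 [enc_list row [i..<n], enc_list lst [i..<n],
      enc_list (\<lambda>v. enc_bool (v \<in> Q)) [i..<n], enc_nat i]
    (Node (encvs (filter (\<lambda>v. v \<in> Q) [i..<n])) (encvs (filter (\<lambda>v. v \<notin> Q) [i..<n])))
    ((n - i) * (30 * q + 150) + 20)"
proof (induction rule: inc_induct)
  case base
  show ?case by (simp add: body)
next
  case (step i)
  have u: "[i..<n] = i # [Suc i..<n]" using step(2) by (rule upt_conv_Cons)
  have "n - i = (n - Suc i) + 1" using step(2) by simp
  then have e: "(n - i) * (30 * q + 150) + 20 = (n - Suc i) * (30 * q + 150) + 20 + (30 * q + 150)"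
    by (simp only: add_mult_distrib mult_1)
  show ?case unfolding u e
    by (auto simp: body encv[of i] simp del: encv_simps
      intro!: fn_call[OF step(3)[unfolded enc_nat.simps]] fn_call[OF opts])
qed

lemma fn_del:
  "fn 24 [encs s, enc_nat i] (enc_bool ((i, 0) \<in> set s)) ((length s + 1) * (20 * i + 80))"
proof (induction s)
  case (Cons p s)
  have e: "(i, 0) \<in> set (p # s) \<longleftrightarrow> (snd p = 0 \<and> i = fst p) \<or> (i, 0) \<in> set s"
    by (cases p) auto
  show ?case unfolding e
    by (auto simp: body algebra_simps intro!: fn_call[OF fn_eq] fn_call[OF Cons.IH])
qed (simp add: body)

text \<open>The adjacency matrix is passed as a clock of length \<open>n\<close>, one tick for each
  entry of the output.\<close>

lemma fn_out:
  "i \<le> n \<Longrightarrow> fn 25 [enc_list row [i..<n], enc_nat i, encs s]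
    (enc_list (\<lambda>v. enc_bool ((v, 0) \<in> set s)) [i..<n])
    ((n - i) * ((length s + 1) * (20 * n + 80) + 50) + 20)"
proof (induction rule: inc_induct)
  case base
  show ?case by (simp add: body)
next
  case (step i)
  define T where "T = (length s + 1) * (20 * n + 80)"
  have u: "[i..<n] = i # [Suc i..<n]" using step(2) by (rule upt_conv_Cons)
  have "n - i = (n - Suc i) + 1" using step(2) by simp
  then have e: "(n - i) * (T + 50) + 20 = (n - Suc i) * (T + 50) + 20 + (T + 50)"
    by (simp only: add_mult_distrib mult_1)
  have 1: "fn 24 [encs s, enc_nat i] (enc_bool ((i, 0) \<in> set s)) T"
    unfolding T_def by (rule fn_mono[OF fn_del]) (use step(2) in \<open>intro mult_left_mono; simp\<close>)
  show ?case unfolding u T_def[symmetric] e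
    by (auto simp: body intro!: fn_call[OF step(3)[unfolded enc_nat.simps T_def[symmetric]]] fn_call[OF 1])
qed

end

section \<open>Solving an instance\<close>

text \<open>For the root \<open>x\<close> of \<open>y ^ D - 1\<close> the ratio
  \<open>r = x / y\<close> satisfies \<open>r ^ D = 1 - 1 / y ^ D\<close>. Lowering the exponent
  from \<open>D\<close> to \<open>j\<close> increases the power of \<open>r\<close> and decreases
  \<open>1 - 1 / y ^ j\<close>, so \<open>D\<close> is the worst case.\<close>

lemma branching_base:
  fixes y :: real
  assumes "2 \<le> y" "1 \<le> D"
  obtains x where "1 \<le> x" "x < y" "\<And>j. 1 \<le> j \<Longrightarrow> j \<le> D \<Longrightarrow> y ^ j - 1 \<le> x ^ j"
proof
  let ?x = "root D (y ^ D - 1)"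
  have D: "0 < D" using assms(2) by simp
  have "y ^ 1 \<le> y ^ D" using assms by (intro power_increasing) auto
  then have ge: "1 \<le> y ^ D - 1" using assms(1) by simp
  then show x1: "1 \<le> ?x" using D by simp
  have xD: "?x ^ D = y ^ D - 1" using ge D by simp
  show xy: "?x < y"
  proof (rule power_less_imp_less_base[of _ D])
    show "?x ^ D < y ^ D" unfolding xD by simp
  qed (use assms in simp)
  fix j :: nat assume j: "1 \<le> j" "j \<le> D"
  define r where "r = ?x / y"
  have r: "0 \<le> r" "r \<le> 1" using x1 xy assms by (simp_all add: r_def)
  have "1 / y ^ D \<le> 1 / y ^ j"
    using assms j(2) by (intro divide_left_mono power_increasing) auto
  then have "1 - 1 / y ^ j \<le> 1 - 1 / y ^ D" by simp
  also have "\<dots> = r ^ D" using assms(1) by (simp add: r_def power_divide xD diff_divide_distrib)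
  also have "\<dots> \<le> r ^ j" using r j(2) by (intro power_decreasing) auto
  finally have "y ^ j * (1 - 1 / y ^ j) \<le> y ^ j * r ^ j"
    using assms(1) by (intro mult_left_mono) auto
  then show "y ^ j - 1 \<le> ?x ^ j"
    using assms(1) by (simp add: r_def power_divide right_diff_distrib)
qed

text \<open>\<open>max 1 n\<close> instead of \<open>n\<close> makes powers monotone in the
  exponent, as closure under addition requires, and covers \<open>n = 0\<close>.\<close>

definition poly_bounded :: "(nat \<Rightarrow> nat) \<Rightarrow> bool" where
  "poly_bounded f \<longleftrightarrow> (\<exists>K c. \<forall>n. f n \<le> K * max 1 n ^ c)"

lemma poly_bounded_const: "poly_bounded (\<lambda>n. k)"
  unfolding poly_bounded_def by (intro exI[of _ k] exI[of _ 0]) simp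

lemma poly_bounded_id: "poly_bounded (\<lambda>n. n)"
  unfolding poly_bounded_def by (intro exI[of _ 1] exI[of _ 1]) simp

lemma poly_bounded_add:
  assumes "poly_bounded f" "poly_bounded g"
  shows "poly_bounded (\<lambda>n. f n + g n)"
proof -
  obtain K c where f: "\<And>n. f n \<le> K * max 1 n ^ c" using assms(1) unfolding poly_bounded_def by blast
  obtain K' c' where g: "\<And>n. g n \<le> K' * max 1 n ^ c'" using assms(2) unfolding poly_bounded_def by blast
  have "f n + g n \<le> (K + K') * max 1 n ^ (c + c')" for n
  proof -
    have "K * max 1 n ^ c \<le> K * max 1 n ^ (c + c')" "K' * max 1 n ^ c' \<le> K' * max 1 n ^ (c + c')"
      by (intro mult_left_mono power_increasing; simp)+
    then show ?thesis using f[of n] g[of n] unfolding add_mult_distrib by linarith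
  qed
  then show ?thesis unfolding poly_bounded_def by blast
qed

lemma poly_bounded_mult:
  assumes "poly_bounded f" "poly_bounded g"
  shows "poly_bounded (\<lambda>n. f n * g n)"
proof -
  obtain K c where f: "\<And>n. f n \<le> K * max 1 n ^ c" using assms(1) unfolding poly_bounded_def by blast
  obtain K' c' where g: "\<And>n. g n \<le> K' * max 1 n ^ c'" using assms(2) unfolding poly_bounded_def by blast
  have "f n * g n \<le> (K * K') * max 1 n ^ (c + c')" for n
    using mult_mono[OF f[of n] g[of n]] by (simp add: power_add mult_ac)
  then show ?thesis unfolding poly_bounded_def by blast
qed

definition setup_time :: "nat \<Rightarrow> nat \<Rightarrow> nat" where
  "setup_time q n = n * (30 * q + 150)
     + (n + 1) * ((n + 2) * ((n + 1) * (20 * n + 50) + 20 * n + 100) + 50)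
     + n * ((n + 1) * (20 * n + 80) + 50) + 200"

text \<open>The powers of \<open>q + 1\<close> have exponents that depend only on \<open>d\<close>
  and \<open>k\<close>, so they are constants here; in \<open>n\<close> the time is built by sums
  and products.\<close>

lemma poly_bounded_total_time:
  "poly_bounded (\<lambda>n. setup_time q n + (n + 1) * node_time q n d k n (n + d + k + 2) (n + 1))"
  unfolding setup_time_def node_time_def find_time_def part_time_def dom_time_def best_time_def
    amin_time_def ext_time_def extl_time_def conf_time_def
  by (intro poly_bounded_const poly_bounded_add poly_bounded_mult poly_bounded_id)

lemma node_time_mono:
  assumes "p \<le> p'" "c \<le> c'"
  shows "node_time q n d k p m c \<le> node_time q n d k p' m c'"
  unfolding node_time_def find_time_def part_time_def
  by (intro add_mono mult_mono) (use assms in auto)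

section \<open>Between graphs with hubs and the abstract setting\<close>

lemma dominates_del_verts:
  "u \<rightarrow>\<^bsub>del_verts G X\<^esub> v \<longleftrightarrow> (u, v) \<in> parcs G \<and> u \<in> pverts G - X \<and> v \<in> pverts G - X"
  by (auto simp: del_verts_def arcs_ends_def arc_to_ends_def)

definition colour_opts :: "nat \<Rightarrow> (nat \<Rightarrow> nat set) \<Rightarrow> nat \<Rightarrow> nat list" where
  "colour_opts q L v = filter (\<lambda>c. c \<in> L v) [1..<Suc q] @ [0]"

lemma set_colour_opts: "set (colour_opts q L v) = insert 0 (L v \<inter> {1..q})"
  by (auto simp: colour_opts_def simp del: upt_Suc)

lemma instance_data_graph:
  assumes "lvd_instance q n G L"
  shows "instance_data q n (\<lambda>u v. (u, v) \<in> parcs G) (colour_opts q L)"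
proof -
  interpret pair_graph G using assms by (simp add: lvd_instance_def)
  have V: "pverts G = {..<n}" using assms by (simp add: lvd_instance_def)
  show ?thesis
  proof
    show "(v, u) \<in> parcs G" if "(u, v) \<in> parcs G" for u v using that by (rule arcs_symmetric)
    show "(v, v) \<notin> parcs G" for v using pair_no_loops[of "(v, v)"] by auto
    show "v < n" if "(u, v) \<in> parcs G" for u v using in_arcsD2[OF that] V by simp
    show "distinct (colour_opts q L v)" for v by (simp add: colour_opts_def del: upt_Suc)
    show "c \<le> q" if "c \<in> set (colour_opts q L v)" for c v using that by (auto simp: set_colour_opts)
    show "0 \<in> set (colour_opts q L v)" for v by (simp add: set_colour_opts)
    show "set (colour_opts q L v) = {0}" if "hd (colour_opts q L v) = 0" for v
    proof (cases "filter (\<lambda>c. c \<in> L v) [1..<Suc q]")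
      case Nil
      then show ?thesis by (simp only: colour_opts_def append_Nil) simp
    next
      case (Cons c cs)
      then have "c \<in> set (filter (\<lambda>c. c \<in> L v) [1..<Suc q])" by (simp only: list.set_intros)
      then have "1 \<le> c" by (simp del: upt_Suc)
      moreover have "hd (colour_opts q L v) = c" by (simp only: colour_opts_def Cons append_Cons list.sel)
      ultimately show ?thesis using that by simp
    qed
  qed
qed

lemma runs_if_fn: "fn 0 [x] y B \<Longrightarrow> \<exists>t \<le> B. runs prog x y t"
  unfolding fn_def callp_def wp_def runs_def by (auto simp: prog_def)

text \<open>It is enough that a part lies inside one strongly connected component of the graph
  without the hub: it then inherits both bounds. Symmetry of the arcs supplies paths in both
  directions.\<close>

lemma hub_parts:
  assumes inst: "lvd_instance q n G L" and hub: "is_hub \<sigma> \<delta> G Q"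
    and W: "distinct W" "set W = {..<n} - Q"
  defines "E \<equiv> \<lambda>u v. (u, v) \<in> parcs G"
  assumes C: "C \<in> set (instance_data.parts E W)"
  shows "length C \<le> \<sigma> \<and> card {y \<in> Q. instance_data.touches E C y} \<le> \<delta>"
proof -
  interpret pair_graph G using inst by (simp add: lvd_instance_def)
  interpret I: instance_data q n E "colour_opts q L"
    unfolding E_def by (rule instance_data_graph[OF inst])
  have V: "pverts G = {..<n}" using inst by (simp add: lvd_instance_def)
  have Q: "Q \<subseteq> {..<n}" using hub V by (simp add: is_hub_def)
  let ?H = "del_verts G Q"
  interpret H: wf_digraph ?H unfolding del_verts_def by (rule wellformed_induce_subgraph)
  have vH: "verts ?H = set W" using W(2) V by (simp add: del_verts_def)
  show ?thesis
  proof (cases C)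
    case Nil
    then show ?thesis by (simp add: I.touches_def)
  next
    case (Cons x C')
    have CW: "set C \<subseteq> set W" using C I.set_parts[of W] by auto
    have conn: "a \<rightarrow>\<^sup>*\<^bsub>?H\<^esub> b" if ab: "a \<in> set C" "b \<in> set C" for a b
    proof (rule I.parts_connected[where R = "reachable ?H", OF _ _ _ C ab])
      show "a \<rightarrow>\<^sup>*\<^bsub>?H\<^esub> a" if "a \<in> set W" for a using that vH by simp
      show "a \<rightarrow>\<^sup>*\<^bsub>?H\<^esub> c" if "a \<rightarrow>\<^sup>*\<^bsub>?H\<^esub> b" "b \<rightarrow>\<^sup>*\<^bsub>?H\<^esub> c" for a b c
        using that by (rule H.reachable_trans)
      show "a \<rightarrow>\<^sup>*\<^bsub>?H\<^esub> b" if "a \<in> set W" "b \<in> set W" "E a b" for a b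
        by (rule H.reachable_adjI) (use that W(2) V in \<open>auto simp: dominates_del_verts E_def\<close>)
    qed
    let ?S = "H.scc_of x"
    have x: "x \<in> set C" using Cons by simp
    have S: "?S \<in> H.sccs_verts" by (rule H.scc_of_in_sccs_verts) (use x CW vH in auto)
    have CS: "set C \<subseteq> ?S" using conn[OF x] conn[OF _ x] by (auto simp: H.scc_of_def)
    have fS: "finite ?S" using H.sccs_verts_subsets[OF S] vH finite_subset by fastforce
    have b: "card ?S \<le> \<sigma>" "card {v \<in> Q. \<exists>u \<in> ?S. (u, v) \<in> parcs G} \<le> \<delta>"
      using hub S by (simp_all add: is_hub_def)
    have "distinct C"
      using I.distinct_parts[OF W(1)] C by (simp add: distinct_concat_iff)
    then have "length C = card (set C)" by (simp add: distinct_card)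
    also have "\<dots> \<le> \<sigma>" using card_mono[OF fS CS] b(1) by linarith
    finally have "length C \<le> \<sigma>" .
    moreover have "card {y \<in> Q. I.touches C y} \<le> card {v \<in> Q. \<exists>u \<in> ?S. (u, v) \<in> parcs G}"
    proof (rule card_mono)
      show "finite {v \<in> Q. \<exists>u \<in> ?S. (u, v) \<in> parcs G}" using Q finite_subset by fastforce
      show "{y \<in> Q. I.touches C y} \<subseteq> {v \<in> Q. \<exists>u \<in> ?S. (u, v) \<in> parcs G}"
        using CS arcs_symmetric unfolding I.touches_def unfolding E_def by blast
    qed
    ultimately show ?thesis using b(2) by linarith
  qed
qed

text \<open>Lists lie within \<open>{1..q}\<close>, so 0 is free to encode deletion: zeros of
  feasible functions are deletion sets, and a deletion set with its colouring yields a feasible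
  function with exactly those zeros.\<close>

lemma optimal_minimum_deletion_set:
  assumes inst: "lvd_instance q n G L"
  defines "E \<equiv> \<lambda>u v. (u, v) \<in> parcs G" and "opts \<equiv> colour_opts q L"
  assumes opt: "instance_data.optimal E opts {..<n} {} f g"
  shows "minimum_deletion_set G L {v. v < n \<and> g v = 0}"
proof -
  interpret I: instance_data q n E opts
    unfolding E_def opts_def by (rule instance_data_graph[OF inst])
  have V: "pverts G = {..<n}" and L: "\<And>v. v < n \<Longrightarrow> L v \<subseteq> {1..q}"
    using inst by (auto simp: lvd_instance_def)
  let ?X = "{v. v < n \<and> g v = 0}"
  have feas: "I.feas g {..<n}" using opt by (simp add: I.optimal_def)
  have "proper_list_coloring (del_verts G ?X) L g"
    unfolding proper_list_coloring_def dominates_del_verts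
  proof (intro conjI ballI allI impI)
    fix v assume "v \<in> verts (del_verts G ?X)"
    then have v: "v < n" "g v \<noteq> 0" using V by (auto simp: del_verts_def)
    then show "g v \<in> L v"
      using I.feas_Opt[OF feas, of v] by (simp add: opts_def set_colour_opts)
  next
    fix u v assume uv: "(u, v) \<in> parcs G \<and> u \<in> pverts G - ?X \<and> v \<in> pverts G - ?X"
    show "g u \<noteq> g v"
    proof
      assume "g u = g v"
      then have "g u = 0" using uv V by (intro I.feasD[OF feas, of u v]) (auto simp: E_def)
      then show False using uv V by simp
    qed
  qed
  then have "deletion_set G L ?X" using V by (auto simp: deletion_set_def)
  moreover have "\<not> card Y < card ?X" if Y: "deletion_set G L Y" for Y
  proof -
    obtain \<phi> where \<phi>: "proper_list_coloring (del_verts G Y) L \<phi>" and YV: "Y \<subseteq> {..<n}"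
      using Y V by (auto simp: deletion_set_def)
    define h where "h v = (if v \<in> Y then 0 else \<phi> v)" for v
    have \<phi>L: "\<phi> v \<in> L v" if "v < n" "v \<notin> Y" for v
      using \<phi> that V by (simp add: proper_list_coloring_def del_verts_def)
    have "I.feas h {..<n}"
    proof (rule I.feasI)
      fix v assume "v \<in> {..<n}"
      then show "h v \<in> set (opts v)" using \<phi>L[of v] L[of v]
        by (auto simp: h_def opts_def set_colour_opts)
    next
      fix u v assume uv: "u \<in> {..<n}" "v \<in> {..<n}" "E u v" "h u = h v"
      show "h u = 0"
      proof (cases "u \<in> Y \<or> v \<in> Y")
        case True
        then show ?thesis using uv(4) by (auto simp: h_def)
      next
        case False
        then have "u \<rightarrow>\<^bsub>del_verts G Y\<^esub> v"
          using uv V unfolding dominates_del_verts E_def by simp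
        then have "\<phi> u \<noteq> \<phi> v" using \<phi> by (simp add: proper_list_coloring_def)
        then show ?thesis using False uv(4) by (simp add: h_def)
      qed
    qed
    then have "I.cost g {..<n} \<le> I.cost h {..<n}" using opt by (simp add: I.optimal_def)
    moreover have "h v = 0 \<longleftrightarrow> v \<in> Y" if "v < n" for v
      using \<phi>L[OF that] L[OF that] by (auto simp: h_def)
    then have "{v \<in> {..<n}. h v = 0} = Y" using YV by auto
    moreover have "{v \<in> {..<n}. g v = 0} = ?X" by auto
    ultimately show ?thesis by (simp add: I.cost_def)
  qed
  ultimately show ?thesis
    unfolding minimum_deletion_set_def is_arg_min_def by blast
qed

text \<open>Starts the recursion with nothing decided. Hub and components together have
  \<open>n\<close> vertices, which is why \<open>n + \<delta> + \<sigma> + 2\<close> bounds the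
  length of all assignments that occur.\<close>

lemma prog_correct:
  fixes x :: real
  assumes q: "1 \<le> q" and x: "1 \<le> x"
      "\<And>j. 1 \<le> j \<Longrightarrow> j \<le> max 2 (\<delta> + 1) \<Longrightarrow> (real q + 1) ^ j - 1 \<le> x ^ j"
    and inst: "lvd_instance q n G L" and hub: "is_hub \<sigma> \<delta> G Q"
  shows "\<exists>X t. runs prog (enc_input q n G L Q) (enc_vertex_set n X) t \<and>
    minimum_deletion_set G L X \<and>
    real t \<le> real (setup_time q n + (n + 1) * node_time q n \<delta> \<sigma> n (n + \<delta> + \<sigma> + 2) (n + 1)) * x ^ card Q"
proof -
  define E where "E = (\<lambda>u v. (u, v) \<in> parcs G)"
  define opts where "opts = colour_opts q L"
  interpret I: instance_data q n E opts
    unfolding E_def opts_def by (rule instance_data_graph[OF inst])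
  have V: "pverts G = {..<n}" using inst by (simp add: lvd_instance_def)
  have Q: "Q \<subseteq> {..<n}" using hub V by (simp add: is_hub_def)
  define H where "H = filter (\<lambda>v. v \<in> Q) [0..<n]"
  define W where "W = filter (\<lambda>v. v \<notin> Q) [0..<n]"
  define Cs where "Cs = I.parts W"
  have H: "distinct H" "set H = Q" unfolding H_def using Q by auto
  have W: "distinct W" "set W = {..<n} - Q" unfolding W_def by auto
  have lH: "length H = card Q" using distinct_card[OF H(1)] H(2) by simp
  have pn: "card Q \<le> n" using card_mono[OF _ Q] by simp
  have lHW: "length H + length W = n"
    unfolding H_def W_def using sum_length_filter_compl[of "\<lambda>v. v \<in> Q" "[0..<n]"] by simp
  have Cs: "\<forall>C \<in> set Cs. length C \<le> \<sigma> \<and> card {y \<in> Q. I.touches C y} \<le> \<delta>"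
    using hub_parts[OF inst hub W] unfolding Cs_def E_def by blast
  have lCs: "length Cs \<le> n + 1" "length (concat Cs) = length W"
    using I.length_parts[of W] I.length_concat_parts[of W] lHW unfolding Cs_def by simp_all
  let ?m = "n + \<delta> + \<sigma> + 2"
  obtain B where B: "fn 17 [enc_list I.encvs Cs, Leaf, I.encvs H] (I.encs (I.solve Cs [] H)) B"
      "real B \<le> (real (card Q) + 1) * real (node_time q n \<delta> \<sigma> (card Q) ?m (length Cs)) * x ^ card Q"
    using I.fn_solve[OF q x Cs, of "card Q" ?m H "[]"] H lH lCs lHW pn finite_subset[OF Q]
    by auto
  have "distinct (concat Cs @ H @ [])"
    using I.distinct_parts[OF W(1)] H W(2) I.set_parts[of W] unfolding Cs_def by auto
  moreover have "I.feas f (set [])" for f by (simp add: I.feas_def)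
  ultimately obtain g ys where g: "I.solve Cs [] H = I.assign g ys" "distinct ys"
      "set ys = set (concat Cs) \<union> set H" "I.optimal (set ys) {} (\<lambda>_. 0) g"
    using I.solve_assign[of Cs H "[]" "\<lambda>_. 0"] I.separated_parts[of W] I.Nil_in_parts[of W]
    unfolding Cs_def by auto
  have ys: "set ys = {..<n}"
    unfolding g(3) using I.set_parts[of W] W(2) H(2) Q unfolding Cs_def by auto
  let ?X = "{v. v < n \<and> g v = 0}"
  have min: "minimum_deletion_set G L ?X"
    by (rule optimal_minimum_deletion_set[OF inst]) (use g(4) ys in \<open>simp add: E_def opts_def\<close>)
  have lys: "length ys = n" using distinct_card[OF g(2)] ys by simp
  let ?row = "\<lambda>u. enc_list (\<lambda>v. enc_bool (E u v)) [0..<n]"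
  let ?lst = "\<lambda>v. enc_list (\<lambda>c. enc_bool (c \<in> L v)) [1..<Suc q]"
  have fn_opts_list: "fn 22 [?lst v, Node Leaf Leaf] (enc_list enc_nat (opts v)) (30 * q + 30)" for v
    using fn_opts[of 1 q "\<lambda>c. c \<in> L v"] by (simp add: opts_def colour_opts_def del: upt_Suc)
  have split: "fn 23 [enc_graph n G, enc_lists q n L, enc_vertex_set n Q, Leaf]
      (Node (I.encvs H) (I.encvs W)) (n * (30 * q + 150) + 20)"
    using I.fn_split[of ?row ?lst 0 Q, OF I.encv_def fn_opts_list]
    by (simp add: enc_graph_def enc_lists_def enc_vertex_set_def E_def H_def W_def del: upt_Suc)
  define T1 where "T1 = (n + 1) * ((n + 2) * ((n + 1) * (20 * n + 50) + 20 * n + 100) + 50)"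
  have parts: "fn 21 [I.encvs W] (enc_list I.encvs Cs) T1"
    unfolding Cs_def T1_def
    by (rule fn_mono[OF I.fn_parts[of W n]]) (use lHW in \<open>simp_all del: mult_Suc mult_Suc_right\<close>)
  define T2 where "T2 = n * ((n + 1) * (20 * n + 80) + 50)"
  have mem: "(v, 0) \<in> set (I.assign g ys) \<longleftrightarrow> v \<in> ?X" for v
    unfolding I.assign_def set_map ys by auto
  have res: "enc_list (\<lambda>v. enc_bool ((v, 0) \<in> set (I.assign g ys))) [0..<n] = enc_vertex_set n ?X"
    unfolding enc_vertex_set_def mem ..
  have out: "fn 25 [enc_graph n G, Leaf, I.encs (I.solve Cs [] H)] (enc_vertex_set n ?X) (T2 + 20)"
    using I.fn_out[of 0 ?row "I.assign g ys"] unfolding res g(1) T2_def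
    by (simp add: enc_graph_def E_def I.assign_def lys del: mult_Suc mult_Suc_right)
  have "fn 0 [enc_input q n G L Q] (enc_vertex_set n ?X) (n * (30 * q + 150) + T1 + T2 + B + 200)"
    by (auto simp: body enc_input_def
      intro!: fn_call[OF split] fn_call[OF parts] fn_call[OF B(1)] fn_call[OF out])
  then obtain t where t: "runs prog (enc_input q n G L Q) (enc_vertex_set n ?X) t"
      "t \<le> n * (30 * q + 150) + T1 + T2 + B + 200"
    using runs_if_fn by blast
  have "real t \<le> real (setup_time q n) + real B"
    using t(2) unfolding setup_time_def T1_def[symmetric] T2_def[symmetric] by linarith
  also have "real B \<le> (real n + 1) * real (node_time q n \<delta> \<sigma> n ?m (n + 1)) * x ^ card Q"
  proof (rule order.trans[OF B(2)], intro mult_right_mono mult_mono)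
    show "real (node_time q n \<delta> \<sigma> (card Q) ?m (length Cs)) \<le> real (node_time q n \<delta> \<sigma> n ?m (n + 1))"
      using node_time_mono[OF pn lCs(1)] by simp
  qed (use pn x(1) in auto)
  also have "real (setup_time q n) \<le> real (setup_time q n) * x ^ card Q"
    using x(1) mult_left_mono[OF one_le_power[OF x(1)], of "real (setup_time q n)"] by simp
  finally have "real t \<le> real (setup_time q n + (n + 1) * node_time q n \<delta> \<sigma> n ?m (n + 1)) * x ^ card Q"
    by (simp add: distrib_right)
  then show ?thesis using t(1) min by blast
qed

theorem theorem7p2:
  fixes q \<delta> :: nat
  assumes "q \<ge> 3"
  shows "\<exists>\<epsilon>::real. \<epsilon> > 0 \<and>
    (\<forall>\<sigma>::nat. \<exists>(P::program) (K::real) (c::nat). \<forall>n G L Q p.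
       lvd_instance q n G L \<and> is_hub \<sigma> \<delta> G Q \<and> card Q = p \<longrightarrow>
       (\<exists>X t. runs P (enc_input q n G L Q) (enc_vertex_set n X) t \<and>
              minimum_deletion_set G L X \<and>
              real t \<le> K * (real q + 1 - \<epsilon>) ^ p * real (max 1 n) ^ c))"
proof -
  \<comment> \<open>\<open>x\<close> is fixed before \<sigma> is known, as the order of the
    quantifiers demands.\<close>
  obtain x where x: "1 \<le> x" "x < real q + 1"
      "\<And>j. 1 \<le> j \<Longrightarrow> j \<le> max 2 (\<delta> + 1) \<Longrightarrow> (real q + 1) ^ j - 1 \<le> x ^ j"
    using branching_base[of "real q + 1" "max 2 (\<delta> + 1)"] assms by auto
  define \<epsilon> where "\<epsilon> = real q + 1 - x"
  have e: "real q + 1 - \<epsilon> = x" by (simp add: \<epsilon>_def)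
  have "\<exists>(P::program) (K::real) (c::nat). \<forall>n G L Q p.
       lvd_instance q n G L \<and> is_hub \<sigma> \<delta> G Q \<and> card Q = p \<longrightarrow>
       (\<exists>X t. runs P (enc_input q n G L Q) (enc_vertex_set n X) t \<and>
              minimum_deletion_set G L X \<and>
              real t \<le> K * (real q + 1 - \<epsilon>) ^ p * real (max 1 n) ^ c)" for \<sigma>
  proof -
    let ?T = "\<lambda>n. setup_time q n + (n + 1) * node_time q n \<delta> \<sigma> n (n + \<delta> + \<sigma> + 2) (n + 1)"
    obtain K c where K: "\<And>n. ?T n \<le> K * max 1 n ^ c"
      using poly_bounded_total_time[of q \<delta> \<sigma>] unfolding poly_bounded_def by blast
    have "\<exists>X t. runs prog (enc_input q n G L Q) (enc_vertex_set n X) t \<and>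
              minimum_deletion_set G L X \<and>
              real t \<le> real K * (real q + 1 - \<epsilon>) ^ p * real (max 1 n) ^ c"
      if "lvd_instance q n G L \<and> is_hub \<sigma> \<delta> G Q \<and> card Q = p" for n G L Q p
    proof -
      have inst: "lvd_instance q n G L" "is_hub \<sigma> \<delta> G Q" "card Q = p" using that by auto
      obtain X t where X: "runs prog (enc_input q n G L Q) (enc_vertex_set n X) t"
          "minimum_deletion_set G L X" "real t \<le> real (?T n) * x ^ p"
        using prog_correct[OF _ x(1,3) inst(1,2)] assms inst(3) by auto
      note X(3)
      also have "real (?T n) * x ^ p \<le> real (K * max 1 n ^ c) * x ^ p"
        by (rule mult_right_mono[OF of_nat_mono[OF K]]) (use x(1) in simp)
      also have "\<dots> = real K * (real q + 1 - \<epsilon>) ^ p * real (max 1 n) ^ c"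
        unfolding e by simp
      finally show ?thesis using X(1,2) by blast
    qed
    then show ?thesis by blast
  qed
  moreover have "\<epsilon> > 0" using x(2) by (simp add: \<epsilon>_def)
  ultimately show ?thesis by blast
qed

end
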